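(* For all $\vec{x}=(a,b,c,d,e,f,g)^T\in V$ we have the relation $$\alpha(\vec{x})K_{p_0}(\vec{x})+\alpha((123)\vec{x})K_{p_1}(\vec{x})+\alpha((132)\vec{x})K_{p_2}(\vec{x})=0,$$ where $(123)\vec{x}=(b,c,a,d,e,f,g)^T$ and $(132)\vec{x}=(c,a,b,d,e,f,g)^T$; in other words, $$\sum_{j=0}^2\alpha((123)^j\vec{x})\,K((123)^j\vec{x})=0.$$ This is a $222$ relation, i.e. the triple $(p_0,p_1,p_2)$ has Hamming type $222$.
   Context: Let $V=\{(a,b,c,d,e,f,g)^T\in\mathbb{C}^7 : e+f+g-a-b-c-d=1\}$. With $(u)_k=u(u+1)\cdots(u+k-1)$, $(u)_0=1$, and ${}_4F_3(a,b,c,d;e,f,g;1)=\sum_{k\ge0}\frac{(a)_k(b)_k(c)_k(d)_k}{k!\,(e)_k(f)_k(g)_k}$, define for $\vec{x}=(a,b,c,d,e,f,g)^T\in V$ $$K(\vec{x})=K(a;b,c,d;e,f,g)=\frac{{}_4F_3(a,b,c,d;e,f,g;1)}{\Gamma(e)\Gamma(f)\Gamma(g)\Gamma(1+a-e)\Gamma(1+a-f)\Gamma(1+a-g)}+\frac{{}_4F_3(a,1+a-e,1+a-f,1+a-g;1+a-b,1+a-c,1+a-d;1)}{\Gamma(1+a-b)\Gamma(1+a-c)\Gamma(1+a-d)\Gamma(b)\Gamma(c)\Gamma(d)},$$ where each ${}_4F_3(A,B,C,D;E,F,G;1)/(\Gamma(E)\Gamma(F)\Gamma(G))$ is read as $\sum_{k\ge0}\frac{(A)_k(B)_k(C)_k(D)_k}{k!\,\Gamma(k+E)\Gamma(k+F)\Gamma(k+G)}$,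 so $K$ is entire on $V$. Put $$\alpha(\vec{x})=\frac{\sin\pi(c-b)}{\Gamma(e-a)\Gamma(f-a)\Gamma(g-a)}.$$ For an element $\mu$ of the group $M_K$ below, $K_\mu(\vec{x})=K(\mu\vec{x})$. The elements $p_0,p_1,p_2\in M_K$ act on $V$ by $p_0\vec{x}=\vec{x}$, $p_1\vec{x}=(b,c,d,a,e,f,g)^T$, $p_2\vec{x}=(c,d,a,b,e,f,g)^T$. Hamming type. Let $S\in GL(7,\mathbb{R})$ be the matrix with rows $(1,0,0,0,0,0,0)$, $(0,0,1,1,0,0,0)$, $(0,1,0,1,0,0,0)$, $(0,1,1,0,0,0,0)$, $(0,1,1,1,1,0,0)$, $(0,1,1,1,0,1,0)$, $(0,1,1,1,0,0,1)$; $P_{1,6}$ the group of $7\times7$ permutation matrices fixing the first coordinate; $G_K=SP_{1,6}S^{-1}$ (under which $K$ is invariant); $M_K\subset GL(7,\mathbb{R})$ the subgroup generated by $G_K$ and the permutation matrix $(12)$. For $1\le i<j\le6$, $\varepsilon=\pm1$, let $M_6^{\varepsilon}(i,j)$ be the $6\times6$ permutation matrix of the transposition $(i\,j)$ with its two off-diagonal $1$'s replaced by $\varepsilon$. There is a unique injective homomorphism $\theta:M_K\to GL(6,\mathbb{R})$ with $S(i,i+1)S^{-1}\mapsto M_6^{+}(i-1,i)$ for $2\le i\le6$ and $(12)\mapsto M_6^{-}(2,3)$. With $\omega_0=(1,1,1,1,1,1)^T$, the Hamming distance between $\mu,\nu\in M_K$ is the number of coordinates in which $\theta(\mu)^{-1}\omega_0$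 and $\theta(\nu)^{-1}\omega_0$ differ (it depends only on the right cosets $G_K\mu,G_K\nu$). The Hamming type of a triple is the list of its three pairwise Hamming distances in nondecreasing order. *)

theory Defs
  imports
    "HOL-Analysis.Analysis"
    "HOL-Algebra.Generated_Groups"
    "HOL-Combinatorics.Cycles"
begin

text \<open>The types \<open>7\<close> and \<open>6\<close> serve as index sets \<open>{1, ..., 7}\<close> and \<open>{1, ..., 6}\<close>;
  as numerals of these types, \<open>7 = 0\<close> and \<open>6 = 0\<close> respectively, so all of
  \<open>x $ 1, ..., x $ 7\<close> are distinct coordinates.\<close>

definition V :: "(complex^7) set" where
  "V = {x. x$5 + x$6 + x$7 - x$1 - x$2 - x$3 - x$4 = 1}"

text \<open>The regularised series \<open>4F3(A,B,C,D;E,F,G;1) / (\<Gamma>(E) \<Gamma>(F) \<Gamma>(G))\<close>;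
  \<^const>\<open>rGamma\<close> is the entire function \<open>1/\<Gamma>\<close>.\<close>

definition F43_reg :: "complex \<Rightarrow> complex \<Rightarrow> complex \<Rightarrow> complex \<Rightarrow> complex \<Rightarrow> complex \<Rightarrow> complex \<Rightarrow> complex" where
  "F43_reg A B C D E F G =
     (\<Sum>k. pochhammer A k * pochhammer B k * pochhammer C k * pochhammer D k / fact k
           * rGamma (of_nat k + E) * rGamma (of_nat k + F) * rGamma (of_nat k + G))"

definition K :: "complex^7 \<Rightarrow> complex" where
  "K x = (let a = x$1; b = x$2; c = x$3; d = x$4; e = x$5; f = x$6; g = x$7 in
     F43_reg a b c d e f g * rGamma (1 + a - e) * rGamma (1 + a - f) * rGamma (1 + a - g)
   + F43_reg a (1 + a - e) (1 + a - f) (1 + a - g) (1 + a - b) (1 + a - c) (1 + a - d)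
       * rGamma b * rGamma c * rGamma d)"

definition \<alpha> :: "complex^7 \<Rightarrow> complex" where
  "\<alpha> x = (let a = x$1; b = x$2; c = x$3; e = x$5; f = x$6; g = x$7 in
     sin (of_real pi * (c - b)) * rGamma (e - a) * rGamma (f - a) * rGamma (g - a))"

definition act :: "real^7^7 \<Rightarrow> complex^7 \<Rightarrow> complex^7" where
  "act \<mu> x = map_matrix of_real \<mu> *v x"

definition K_mu :: "real^7^7 \<Rightarrow> complex^7 \<Rightarrow> complex" where
  "K_mu \<mu> x = K (act \<mu> x)"

text \<open>The convention for permutation matrices is \<open>(perm_matrix \<sigma> *v x) $ i = x $ \<sigma> i\<close>, so that
  the cycle \<open>(123)\<close> sends \<open>(a,b,c,d,e,f,g)\<close> to \<open>(b,c,a,d,e,f,g)\<close>.\<close>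

definition perm_matrix :: "('n \<Rightarrow> 'n) \<Rightarrow> real^'n^'n" where
  "perm_matrix \<sigma> = (\<chi> i j. if j = \<sigma> i then 1 else 0)"

definition c123 :: "real^7^7" where "c123 = perm_matrix (cycle_of_list [1, 2, 3])"

definition c132 :: "real^7^7" where "c132 = perm_matrix (cycle_of_list [1, 3, 2])"

definition p0 :: "real^7^7" where "p0 = mat 1"

definition p1 :: "real^7^7" where "p1 = perm_matrix (cycle_of_list [1, 2, 3, 4])"

definition p2 :: "real^7^7" where "p2 = perm_matrix (cycle_of_list [1, 3] \<circ> cycle_of_list [2, 4])"

definition GL :: "(real^'n^'n) monoid" where
  "GL = \<lparr>carrier = {A. invertible A}, monoid.mult = (**), one = mat 1\<rparr>"

definition S :: "real^7^7" where
  "S = vector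
    [vector [1,0,0,0,0,0,0],
     vector [0,0,1,1,0,0,0],
     vector [0,1,0,1,0,0,0],
     vector [0,1,1,0,0,0,0],
     vector [0,1,1,1,1,0,0],
     vector [0,1,1,1,0,1,0],
     vector [0,1,1,1,0,0,1]]"

definition P16 :: "(real^7^7) set" where
  "P16 = {perm_matrix \<sigma> |\<sigma>. \<sigma> permutes UNIV \<and> \<sigma> 1 = 1}"

definition G_K :: "(real^7^7) set" where
  "G_K = {S ** P ** matrix_inv S |P. P \<in> P16}"

definition M_K :: "(real^7^7) set" where
  "M_K = generate GL (G_K \<union> {perm_matrix (Transposition.transpose 1 2)})"

definition M6 :: "real \<Rightarrow> 6 \<Rightarrow> 6 \<Rightarrow> real^6^6" where
  "M6 \<epsilon> i j = (\<chi> k l. if (k, l) = (i, j) \<or> (k, l) = (j, i) then \<epsilon>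
                      else perm_matrix (Transposition.transpose i j) $ k $ l)"

text \<open>Extensionality pins down the (irrelevant) values outside \<open>M_K\<close>, which makes the
  homomorphism unique as a HOL function.\<close>

definition \<theta> :: "real^7^7 \<Rightarrow> real^6^6" where
  "\<theta> = (THE h. h \<in> extensional M_K
             \<and> h \<in> hom (GL\<lparr>carrier := M_K\<rparr>) GL
             \<and> inj_on h M_K
             \<and> (\<forall>i::nat\<in>{2..6}.
                  h (S ** perm_matrix (Transposition.transpose (of_nat i) (of_nat (i + 1))) ** matrix_inv S)
                    = M6 1 (of_nat (i - 1)) (of_nat i))
             \<and> h (perm_matrix (Transposition.transpose 1 2)) = M6 (-1) 2 3)"

definition \<omega>\<^sub>0 :: "real^6" where "\<omega>\<^sub>0 = vec 1"

definition hamming_dist :: "real^7^7 \<Rightarrow> real^7^7 \<Rightarrow> nat" where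
  "hamming_dist \<mu> \<nu> =
     card {i. (matrix_inv (\<theta> \<mu>) *v \<omega>\<^sub>0) $ i \<noteq> (matrix_inv (\<theta> \<nu>) *v \<omega>\<^sub>0) $ i}"

definition hamming_type :: "real^7^7 \<Rightarrow> real^7^7 \<Rightarrow> real^7^7 \<Rightarrow> nat list" where
  "hamming_type \<mu> \<nu> \<rho> = sort [hamming_dist \<mu> \<nu>, hamming_dist \<mu> \<rho>, hamming_dist \<nu> \<rho>]"

lemma UNIV_7: "(UNIV :: 7 set) = {1, 2, 3, 4, 5, 6, 7}"
proof (rule sym, rule card_subset_eq)
  show "card {1, 2, 3, 4, 5, 6, 7 :: 7} = card (UNIV :: 7 set)" by simp
qed auto

lemma forall_7: "(\<forall>i::7. P i) \<longleftrightarrow> P 1 \<and> P 2 \<and> P 3 \<and> P 4 \<and> P 5 \<and> P 6 \<and> P 7"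
  by (metis UNIV_7 UNIV_I empty_iff insert_iff)

lemma vector_7 [simp]:
  "(vector [a,b,c,d,e,f,g] :: 'a::zero^7) $ 1 = a"
  "(vector [a,b,c,d,e,f,g] :: 'a::zero^7) $ 2 = b"
  "(vector [a,b,c,d,e,f,g] :: 'a::zero^7) $ 3 = c"
  "(vector [a,b,c,d,e,f,g] :: 'a::zero^7) $ 4 = d"
  "(vector [a,b,c,d,e,f,g] :: 'a::zero^7) $ 5 = e"
  "(vector [a,b,c,d,e,f,g] :: 'a::zero^7) $ 6 = f"
  "(vector [a,b,c,d,e,f,g] :: 'a::zero^7) $ 7 = g"
  unfolding vector_def by simp_all

lemma act_perm_matrix: "act (perm_matrix \<sigma>) x = (\<chi> i. x $ \<sigma> i)"
  by (simp add: act_def perm_matrix_def matrix_vector_mult_def vec_eq_iff if_distrib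
      if_distribR cong: if_cong)

lemma act_explicit:
  fixes a b c d e f g :: complex
  defines "x \<equiv> vector [a,b,c,d,e,f,g] :: complex^7"
  shows "act p0 x = vector [a,b,c,d,e,f,g]"
    and "act p1 x = vector [b,c,d,a,e,f,g]"
    and "act p2 x = vector [c,d,a,b,e,f,g]"
    and "act c123 x = vector [b,c,a,d,e,f,g]"
    and "act c132 x = vector [c,a,b,d,e,f,g]"
proof -
  have p0: "p0 = perm_matrix id"
    by (auto simp: p0_def perm_matrix_def mat_def vec_eq_iff)
  show "act p0 x = vector [a,b,c,d,e,f,g]"
    unfolding p0 act_perm_matrix x_def by (simp add: vec_eq_iff)
qed (simp_all add: p1_def p2_def c123_def c132_def act_perm_matrix x_def vec_eq_iff forall_7
       Transposition.transpose_def)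

end

theory Submission
  imports Defs "HOL-Complex_Analysis.Complex_Analysis" "HOL-Real_Asymp.Real_Asymp"
begin

text \<open>All residues of the integrand
  \<open>\<Gamma>(a+t) \<Gamma>(b+t) \<Gamma>(c+t) \<Gamma>(-t) / (\<Gamma>(e+t) \<Gamma>(f+t) \<Gamma>(g+t) \<Gamma>(1-d-t))\<close> sum to zero. The residues at
  \<open>t = k\<close> give the first series of \<open>K\<close>, those at \<open>-a-k\<close>, \<open>-b-k\<close>, \<open>-c-k\<close> the second series of the three
  \<open>K\<close>-values, and the coefficients of the first series match by a trigonometric identity. Instead of
  contour integrals, the Gamma functions are truncated to finite products: the residues of a rational
  function of degree at most \<open>-2\<close> sum to zero, and one passes to the limit for generic parameters with
  \<open>Re d = 2\<close>. Both sides are entire along complex lines in \<open>V\<close>, which gives all parameters.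

  For the Hamming type, a linear map from \<open>\<real>\<^sup>7\<close> onto \<open>\<real>\<^sup>6\<close> intertwines \<open>M_K\<close> with signed permutation
  matrices; together with the invariant form \<open>e+f+g-a-b-c-d\<close> it is injective, which yields \<open>\<theta>\<close>.\<close>

text \<open>Otherwise \<open>x $ i\<close> is ambiguous between vectors and formal power series, and parsing blows up.\<close>

no_notation fps_nth (infixl "$" 75)

section \<open>Growth of Pochhammer symbols and the reciprocal Gamma function\<close>

text \<open>The integrand has \<open>1/Gamma(1-d-t)\<close> where \<open>Gamma(d+t)\<close> might be
  expected. This removes the poles that \<open>d\<close> would contribute, while the residues at
  \<open>t = k\<close> still contain \<open>(d)_k\<close>: one first series, but only three second
  series. The lengths of the truncated products are forced. Suppose that the product for
  \<open>1-d-t\<close> has length \<open>m + s\<close>. Each residue is a hypergeometric term times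
  a factor in \<open>m + k\<close> and a factor in \<open>m - k\<close>. By the condition defining
  \<open>V\<close>, one of these grows like \<open>n^(d-2)\<close> and the other like
  \<open>n^(s-d)\<close>, so for fixed \<open>k\<close> their product has order
  \<open>m^(s-2)\<close>. Only \<open>s = 2\<close> gives a finite nonzero limit, and
  \<open>s = 2\<close> is also the largest value for which the degree is at most \<open>-2\<close>.
  What is left is \<open>((m-k)/(m+k))^w\<close> with \<open>w = 2 - d\<close> at the poles
  \<open>t = k\<close> and \<open>w = d - 2\<close> at the others. A bound by 1 for both needs
  \<open>Re w \<ge> 0\<close> in both cases, which singles out the line \<open>Re d = 2\<close>. The
  continuation needs bounds on the series that are locally uniform in all parameters; these are read
  off from finite products by telescoping.\<close>

lemma norm_one_plus_le_exp:
  fixes w :: complex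
  shows "norm (1 + w) \<le> exp (Re w + (norm w)\<^sup>2 / 2)"
proof (rule power2_le_imp_le)
  \<comment> \<open>The squared modulus is 1 plus a real number, so the real inequality
    \<open>1 + x \<le> exp x\<close> suffices and no complex logarithm is needed, even near
    \<open>w = -1\<close>.\<close>
  have "(norm (1 + w))\<^sup>2 = 1 + (2 * Re w + (norm w)\<^sup>2)"
    unfolding cmod_power2 by (simp add: power2_eq_square algebra_simps)
  also have "\<dots> \<le> exp (2 * Re w + (norm w)\<^sup>2)" by (rule exp_ge_add_one_self)
  also have "\<dots> = (exp (Re w + (norm w)\<^sup>2 / 2))\<^sup>2"
    by (simp add: exp_double [symmetric] algebra_simps)
  finally show "(norm (1 + w))\<^sup>2 \<le> (exp (Re w + (norm w)\<^sup>2 / 2))\<^sup>2" .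
qed simp

text \<open>With \<open>w = (z - 1)/(n + 1)\<close> the factor is \<open>(n + 1)(1 + w)\<close>. The
  first-order part \<open>(Re z - 1)/(n + 1)\<close> of the exponent is traded for a difference of
  logarithms, which will telescope; the price is an error of order
  \<open>1/(n + 1)^2\<close>.\<close>

lemma norm_pochhammer_step:
  fixes z :: complex
  assumes R: "norm (z - 1) \<le> R"
  shows "norm (z + of_nat n) \<le>
    of_nat (Suc n) * exp ((Re z - 1) * (ln (real n + 2) - ln (real n + 1)) + (R\<^sup>2 / 2 + R) / (real n + 1)\<^sup>2)"
proof -
  have R0: "0 \<le> R" using R norm_ge_zero order_trans by blast
  define h :: real where "h = 1 / (real n + 1)"
  have h: "0 < h" "h \<le> 1" by (auto simp: h_def)
  define w :: complex where "w = (z - 1) * of_real h"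
  have "h * real (Suc n) = 1" by (simp add: h_def)
  then have "complex_of_real (h * real (Suc n)) = of_real 1" by (rule arg_cong)
  then have hn: "complex_of_real h * of_nat (Suc n) = 1" by (simp only: of_real_mult of_real_of_nat_eq of_real_1)
  have "of_nat (Suc n) * (1 + w) = of_nat (Suc n) + (z - 1) * (of_real h * of_nat (Suc n))"
    by (simp only: w_def ring_distribs mult_ac mult_1)
  then have "z + of_nat n = of_nat (Suc n) * (1 + w)" by (simp only: hn) simp
  then have "norm (z + of_nat n) = of_nat (Suc n) * norm (1 + w)"
    by (simp add: norm_mult del: of_nat_Suc)
  moreover have "norm (1 + w) \<le> exp (Re w + (norm w)\<^sup>2 / 2)"
    by (rule norm_one_plus_le_exp)
  moreover have "Re w + (norm w)\<^sup>2 / 2 \<le> (Re z - 1) * (ln (real n + 2) - ln (real n + 1)) + (R\<^sup>2 / 2 + R) * h\<^sup>2"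
  proof -
    have "ln (real n + 2) - ln (real n + 1) = ln ((real n + 2) / (real n + 1))"
      by (simp add: ln_div)
    also have "(real n + 2) / (real n + 1) = 1 + h" by (simp add: h_def field_simps)
    finally have l: "ln (real n + 2) - ln (real n + 1) = ln (1 + h)" .
    have "\<bar>ln (1 + h) - h\<bar> \<le> h\<^sup>2"
      using h by (intro abs_ln_one_plus_x_minus_x_bound_nonneg) auto
    then have "\<bar>(Re z - 1) * (h - ln (1 + h))\<bar> \<le> R * h\<^sup>2"
      unfolding abs_mult using abs_Re_le_cmod[of "z - 1"] R R0
      by (intro mult_mono) auto
    then have "(Re z - 1) * h \<le> (Re z - 1) * ln (1 + h) + R * h\<^sup>2"
      by (simp add: algebra_simps abs_le_iff)
    moreover have "Re w = (Re z - 1) * h" by (simp add: w_def)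
    moreover have "(norm w)\<^sup>2 \<le> R\<^sup>2 * h\<^sup>2"
      using R R0 h by (simp add: w_def norm_mult power_mult_distrib mult_right_mono power_mono)
    ultimately show ?thesis unfolding l by (simp add: algebra_simps)
  qed
  moreover have "(R\<^sup>2 / 2 + R) * h\<^sup>2 = (R\<^sup>2 / 2 + R) / (real n + 1)\<^sup>2"
    by (simp add: h_def power_divide)
  ultimately show ?thesis
    by (smt (verit, best) exp_le_cancel_iff mult_left_mono of_nat_0_le_iff)
qed

text \<open>Multiplying the one-step bounds, the logarithms telescope. The quadratic errors are
  dominated by multiples of \<open>1/(n+1) - 1/(n+2)\<close>, which telescope as well, so the
  constant depends on \<open>R\<close> only and not on \<open>z\<close>, \<open>k\<close> or
  \<open>m\<close>.\<close>

lemma norm_pochhammer_shift_le: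
  fixes z :: complex
  assumes R: "norm (z - 1) \<le> R"
  shows "norm (pochhammer (z + of_nat k) m) \<le> fact (k + m) / fact k *
    exp ((Re z - 1) * (ln (real (k + m) + 1) - ln (real k + 1))
         + (R\<^sup>2 + 2 * R) * (1 / (real k + 1) - 1 / (real (k + m) + 1)))"
proof (induction m)
  case 0
  then show ?case by simp
next
  case (Suc m)
  define n where "n = k + m"
  define C where "C = R\<^sup>2 + 2 * R"
  have R0: "0 \<le> R" using R norm_ge_zero order_trans by blast
  then have C0: "C \<ge> 0" unfolding C_def by auto
  have t: "(R\<^sup>2 / 2 + R) / (real n + 1)\<^sup>2 \<le> C * (1 / (real n + 1) - 1 / (real n + 2))"
  proof -
    have "1 / (real n + 1)\<^sup>2 \<le> 2 * (1 / (real n + 1) - 1 / (real n + 2))"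
    proof -
      have "1 / (x + 1)\<^sup>2 \<le> 2 * (1 / (x + 1) - 1 / (x + 2))" if "x \<ge> 0" for x :: real
        using that by (simp add: divide_simps power2_eq_square)
      then show ?thesis by simp
    qed
    then have "C / 2 * (1 / (real n + 1)\<^sup>2) \<le> C / 2 * (2 * (1 / (real n + 1) - 1 / (real n + 2)))"
      using C0 by (intro mult_left_mono) auto
    also have "\<dots> = C * (1 / (real n + 1) - 1 / (real n + 2))" by simp
    finally have "C / 2 / (real n + 1)\<^sup>2 \<le> C * (1 / (real n + 1) - 1 / (real n + 2))" by simp
    moreover have "C / 2 = R\<^sup>2 / 2 + R" by (simp add: C_def)
    ultimately show ?thesis by (simp only:)
  qed
  have "norm (pochhammer (z + of_nat k) (Suc m)) = norm (pochhammer (z + of_nat k) m) * norm (z + of_nat n)"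
    by (simp add: pochhammer_Suc norm_mult n_def add_ac)
  also have "\<dots> \<le> (fact n / fact k * exp ((Re z - 1) * (ln (real n + 1) - ln (real k + 1))
         + C * (1 / (real k + 1) - 1 / (real n + 1)))) * 
     (of_nat (Suc n) * exp ((Re z - 1) * (ln (real n + 2) - ln (real n + 1)) + C * (1 / (real n + 1) - 1 / (real n + 2))))"
    using Suc.IH norm_pochhammer_step[OF R, of n] t unfolding n_def[symmetric] C_def[symmetric]
    by (intro mult_mono) (auto elim!: order_trans intro!: mult_left_mono simp del: of_nat_Suc)
  also have "\<dots> = fact (Suc n) / fact k * (exp ((Re z - 1) * (ln (real n + 1) - ln (real k + 1))
         + C * (1 / (real k + 1) - 1 / (real n + 1))) * exp ((Re z - 1) * (ln (real n + 2) - ln (real n + 1)) + C * (1 / (real n + 1) - 1 / (real n + 2))))"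
    by simp
  also have "\<dots> = fact (Suc n) / fact k * exp ((Re z - 1) * (ln (real n + 2) - ln (real k + 1))
         + C * (1 / (real k + 1) - 1 / (real n + 2)))"
    unfolding exp_add [symmetric] by (simp add: algebra_simps)
  finally show ?case by (simp add: n_def C_def add_ac)
qed

lemma norm_pochhammer_le:
  fixes z :: complex
  assumes R: "norm (z - 1) \<le> R"
  shows "norm (pochhammer z k) \<le> exp (R\<^sup>2 + 2 * R) * fact k * exp ((Re z - 1) * ln (real k + 1))"
proof -
  have R0: "0 \<le> R" using R norm_ge_zero order_trans by blast
  have "norm (pochhammer z k) \<le> fact k *
    exp ((Re z - 1) * ln (real k + 1) + (R\<^sup>2 + 2 * R) * (1 - 1 / (real k + 1)))"
    using norm_pochhammer_shift_le[OF R, of 0 k] by simp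
  also have "\<dots> \<le> fact k * exp ((Re z - 1) * ln (real k + 1) + (R\<^sup>2 + 2 * R))"
    using R0 by (simp add: mult_left_le)
  finally show ?thesis by (simp add: exp_add mult_ac)
qed

text \<open>The approximants \<open>rGamma_series\<close> have a Pochhammer symbol in the numerator,
  so the upper bound above transfers to \<open>rGamma\<close> in the limit and no lower bound for
  \<open>Gamma\<close> is required.\<close>

lemma norm_rGamma_shift_le:
  fixes z :: complex
  assumes R: "norm (z - 1) \<le> R"
  shows "norm (rGamma (of_nat k + z)) \<le> exp (R\<^sup>2 + 2 * R) / fact k * exp ((1 - Re z) * ln (real k + 1))"
proof (rule LIMSEQ_le)
  have R0: "0 \<le> R" using R norm_ge_zero order_trans by blast
  define u where "u = of_nat k + z"
  show "(\<lambda>n. norm (rGamma_series u n)) \<longlonglongrightarrow> norm (rGamma (of_nat k + z))"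
    unfolding u_def by (intro tendsto_intros)
  define C where "C = exp (R\<^sup>2 + 2 * R)"
  define x where "x = Re z"
  \<comment> \<open>The claimed bound times two correction factors, each of which tends to
    1.\<close>
  define B where "B n = C / fact k * exp ((1 - x) * ln (real k + 1)) * 
     (fact (k + n + 1) / (fact n * real n powr (real k + 1)))
     * ((real (k + n) + 2) / real n) powr (x - 1)" for n
  have lim1: "(\<lambda>n. fact (k + n + 1) / (fact n * real n powr (real k + 1))) \<longlonglongrightarrow> 1"
  proof -
    have "(\<lambda>n. fact (k + n + 1) / (fact n * real n powr (real k + 1))) \<longlonglongrightarrow> 1" if "k = k'" for k'
      using that
    proof (induction k' arbitrary: k)
      case 0
      have "(\<lambda>n. (real n + 1) / real n) \<longlonglongrightarrow> 1" by real_asymp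
      moreover have "eventually (\<lambda>n. (real n + 1) / real n = fact (k + n + 1) / (fact n * real n powr (real k + 1))) sequentially"
        using eventually_gt_at_top[of 0] by eventually_elim (use 0 in simp)
      ultimately show ?case using Lim_transform_eventually by fast
    next
      case (Suc k')
      have "(\<lambda>n. (fact (k' + n + 1) / (fact n * real n powr (real k' + 1))) * ((real n + real k' + 2) / real n)) \<longlonglongrightarrow> 1 * 1"
        by (intro tendsto_mult Suc.IH) (auto, real_asymp)
      moreover have "eventually (\<lambda>n. (fact (k' + n + 1) / (fact n * real n powr (real k' + 1))) * ((real n + real k' + 2) / real n)
        = fact (k + n + 1) / (fact n * real n powr (real k + 1))) sequentially"
        using eventually_gt_at_top[of 0]
        by eventually_elim (use Suc.prems in \<open>simp add: powr_add field_simps power2_eq_square\<close>)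
      ultimately show ?case using Lim_transform_eventually by fastforce
    qed
    then show ?thesis by simp
  qed
  have lim2: "(\<lambda>n. ((real (k + n) + 2) / real n) powr (x - 1)) \<longlonglongrightarrow> 1"
  proof -
    have "(\<lambda>n. (real (k + n) + 2) / real n) \<longlonglongrightarrow> 1"
      by real_asymp
    then have "(\<lambda>n. ((real (k + n) + 2) / real n) powr (x - 1)) \<longlonglongrightarrow> 1 powr (x - 1)"
      by (intro tendsto_powr tendsto_const) auto
    then show ?thesis by simp
  qed
  have "B \<longlonglongrightarrow> C / fact k * exp ((1 - x) * ln (real k + 1)) * 1 * 1"
    unfolding B_def by (intro tendsto_mult tendsto_const lim1 lim2)
  then show "B \<longlonglongrightarrow> exp (R\<^sup>2 + 2 * R) / fact k * exp ((1 - Re z) * ln (real k + 1))"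
    by (simp add: C_def x_def)
  show "\<exists>N. \<forall>n\<ge>N. norm (rGamma_series u n) \<le> B n"
  proof (intro exI[of _ 1] allI impI)
    fix n :: nat assume n: "n \<ge> 1"
    have "norm (pochhammer u (n + 1)) \<le> fact (k + (n + 1)) / fact k *
      exp ((x - 1) * (ln (real (k + (n + 1)) + 1) - ln (real k + 1))
         + (R\<^sup>2 + 2 * R) * (1 / (real k + 1) - 1 / (real (k + (n + 1)) + 1)))"
      using norm_pochhammer_shift_le[OF R, of k "n + 1"] by (simp add: u_def x_def add_ac)
    also have "\<dots> \<le> fact (k + (n + 1)) / fact k *
      exp ((x - 1) * (ln (real (k + (n + 1)) + 1) - ln (real k + 1)) + (R\<^sup>2 + 2 * R))"
    proof -
      have "1 / (real k + 1) - 1 / (real (k + (n + 1)) + 1) \<le> 1"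
        by (smt (verit) divide_le_eq_1 of_nat_0_le_iff zero_le_divide_1_iff)
      then show ?thesis using R0 by (simp add: mult_left_le divide_right_mono)
    qed
    also have "\<dots> = fact (k + n + 1) / fact k * C *
        (exp ((1 - x) * ln (real k + 1)) * exp ((x - 1) * ln (real (k + n) + 2)))"
      by (simp add: C_def exp_add [symmetric] algebra_simps flip: exp_add)
    finally have 1: "norm (pochhammer u (n + 1)) \<le> \<dots>" .
    have 2: "norm (fact n * exp (u * of_real (ln (of_nat n)))) = fact n * exp ((real k + x) * ln (real n))"
      by (simp add: norm_mult u_def x_def)
    have "norm (rGamma_series u n) \<le> (fact (k + n + 1) / fact k * C *
        (exp ((1 - x) * ln (real k + 1)) * exp ((x - 1) * ln (real (k + n) + 2)))) / (fact n * exp ((real k + x) * ln (real n)))"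
      unfolding rGamma_series_def norm_divide 2 by (intro divide_right_mono 1) auto
    also have "\<dots> = C / fact k * exp ((1 - x) * ln (real k + 1)) * (fact (k + n + 1) / fact n) * (exp ((x - 1) * ln (real (k + n) + 2)) / exp ((real k + x) * ln (real n)))"
      by (simp add: field_simps)
    also have "exp ((x - 1) * ln (real (k + n) + 2)) / exp ((real k + x) * ln (real n))
       = ((real (k + n) + 2) / real n) powr (x - 1) / real n powr (real k + 1)"
      using n by (simp add: powr_def ln_div exp_diff [symmetric] algebra_simps)
    finally show "norm (rGamma_series u n) \<le> B n" unfolding B_def by (simp add: field_simps)
  qed
qed

section \<open>The regularised series as a holomorphic function of its parameters\<close>

definition F43_term :: "complex \<Rightarrow> complex \<Rightarrow> complex \<Rightarrow> complex \<Rightarrow> complex \<Rightarrow> complex \<Rightarrow> complex \<Rightarrow> nat \<Rightarrow> complex" where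
  "F43_term A B C D E F G k =
     pochhammer A k * pochhammer B k * pochhammer C k * pochhammer D k / fact k
       * rGamma (of_nat k + E) * rGamma (of_nat k + F) * rGamma (of_nat k + G)"

lemma F43_reg_altdef: "F43_reg A B C D E F G = (\<Sum>k. F43_term A B C D E F G k)"
  by (simp add: F43_reg_def F43_term_def)

text \<open>Four Pochhammer symbols against \<open>fact k\<close> and three values of
  \<open>rGamma\<close>: the factorials cancel, and the remaining powers of \<open>k + 1\<close>
  have total exponent \<open>-2\<close> exactly because of the parameter condition. The constant
  depends on \<open>R\<close> alone, as the M-test requires.\<close>

lemma norm_F43_term_le:
  assumes saal: "E + F + G - A - B - C - D = 1"
    and R: "norm (A - 1) \<le> R" "norm (B - 1) \<le> R" "norm (C - 1) \<le> R" "norm (D - 1) \<le> R"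
      "norm (E - 1) \<le> R" "norm (F - 1) \<le> R" "norm (G - 1) \<le> R"
  shows "norm (F43_term A B C D E F G k) \<le> exp (R\<^sup>2 + 2 * R) ^ 7 * inverse (real (Suc k) ^ 2)"
proof -
  define M where "M = exp (R\<^sup>2 + 2 * R)"
  define L where "L = ln (real k + 1)"
  have M: "M > 0" by (simp add: M_def)
  have p: "norm (pochhammer z k) \<le> M * fact k * exp ((Re z - 1) * L)" if "norm (z - 1) \<le> R" for z
    using norm_pochhammer_le[OF that, of k] by (simp only: M_def L_def)
  have r: "norm (rGamma (of_nat k + z)) \<le> M / fact k * exp ((1 - Re z) * L)" if "norm (z - 1) \<le> R" for z
    using norm_rGamma_shift_le[OF that, of k] by (simp only: M_def L_def)
  have cancel: "M * q * a * (M * q * b) * (M * q * c) * (M * q * d) / q * (M / q * e) * (M / q * f) * (M / q * g)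
      = M ^ 7 * (a * b * c * d * e * f * g)" if "q \<noteq> 0" for q a b c d e f g :: real
  proof -
    have *: "M * q * a * (M * q * b) * (M * q * c) * (M * q * d) * r * (M * r * e) * (M * r * f) * (M * r * g)
      = M ^ 7 * (a * b * c * d * e * f * g) * (q * r) ^ 4" for r
      by algebra
    show ?thesis
      unfolding divide_inverse *[of "inverse q"] right_inverse[OF that] by simp
  qed
  have prod: "x1 * x2 * x3 * x4 / q * x5 * x6 * x7 \<le> y1 * y2 * y3 * y4 / q * y5 * y6 * y7"
    if "x1 \<le> y1" "x2 \<le> y2" "x3 \<le> y3" "x4 \<le> y4" "x5 \<le> y5" "x6 \<le> y6" "x7 \<le> y7"
      "0 \<le> x1" "0 \<le> x2" "0 \<le> x3" "0 \<le> x4" "0 \<le> x5" "0 \<le> x6" "0 \<le> x7" "0 < q"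
    for x1 x2 x3 x4 x5 x6 x7 y1 y2 y3 y4 y5 y6 y7 q :: real
    using that by (intro mult_mono divide_right_mono mult_nonneg_nonneg divide_nonneg_nonneg) auto
  have "norm (F43_term A B C D E F G k) \<le>
     (M * fact k * exp ((Re A - 1) * L)) * (M * fact k * exp ((Re B - 1) * L)) *
     (M * fact k * exp ((Re C - 1) * L)) * (M * fact k * exp ((Re D - 1) * L)) / fact k *
     (M / fact k * exp ((1 - Re E) * L)) * (M / fact k * exp ((1 - Re F) * L)) * (M / fact k * exp ((1 - Re G) * L))"
    unfolding F43_term_def norm_mult norm_divide norm_fact
    by (rule prod) (rule p r R norm_ge_zero fact_gt_zero)+
  also have "\<dots> = M ^ 7 * (exp ((Re A - 1) * L) * exp ((Re B - 1) * L) * exp ((Re C - 1) * L) * exp ((Re D - 1) * L)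
     * exp ((1 - Re E) * L) * exp ((1 - Re F) * L) * exp ((1 - Re G) * L))"
    by (rule cancel) simp
  also have "exp ((Re A - 1) * L) * exp ((Re B - 1) * L) * exp ((Re C - 1) * L) * exp ((Re D - 1) * L)
     * exp ((1 - Re E) * L) * exp ((1 - Re F) * L) * exp ((1 - Re G) * L)
     = exp (- (Re (E + F + G - A - B - C - D) + 1) * L)"
    unfolding exp_add [symmetric] by (rule arg_cong[of _ _ exp]) (simp add: algebra_simps)
  also have "\<dots> = inverse (exp L ^ 2)"
    unfolding saal exp_double [symmetric] exp_minus [symmetric] by (rule arg_cong[of _ _ exp]) simp
  also have "exp L = real (Suc k)" by (simp add: L_def add_ac)
  finally show ?thesis unfolding M_def .
qed

lemma summable_inverse_Suc_square: "summable (\<lambda>k. c * inverse (real (Suc k) ^ 2))"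
proof -
  have "summable (\<lambda>k. inverse (real (Suc k) ^ 2))"
    by (subst summable_Suc_iff[where f = "\<lambda>k. inverse (real k ^ 2)"]) (simp add: inverse_power_summable)
  then show ?thesis by (rule summable_mult)
qed

lemma summable_F43_term:
  assumes "E + F + G - A - B - C - D = 1"
  shows "summable (\<lambda>k. norm (F43_term A B C D E F G k))"
proof -
  define R where "R = norm (A - 1) + norm (B - 1) + norm (C - 1) + norm (D - 1) + norm (E - 1) + norm (F - 1) + norm (G - 1)"
  have "norm (F43_term A B C D E F G k) \<le> exp (R\<^sup>2 + 2 * R) ^ 7 * inverse (real (Suc k) ^ 2)" for k
    using assms by (rule norm_F43_term_le) (simp_all add: R_def)
  moreover note summable_inverse_Suc_square[of "exp (R\<^sup>2 + 2 * R) ^ 7"]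
  ultimately show ?thesis
    by (intro summable_norm_comparison_test[where g = "\<lambda>k. exp (R\<^sup>2 + 2 * R) ^ 7 * inverse (real (Suc k) ^ 2)"] exI[of _ 0])
      blast+
qed

lemma holomorphic_pochhammer [holomorphic_intros]:
  "f holomorphic_on A \<Longrightarrow> (\<lambda>z. pochhammer (f z) n) holomorphic_on A"
  unfolding pochhammer_prod by (intro holomorphic_intros)

lemma uniform_limit_F43_reg:
  assumes saal: "\<And>z. z \<in> X \<Longrightarrow> E z + F z + G z - A z - B z - C z - D z = 1"
    and R: "\<And>z. z \<in> X \<Longrightarrow> norm (A z - 1) \<le> R" "\<And>z. z \<in> X \<Longrightarrow> norm (B z - 1) \<le> R"
      "\<And>z. z \<in> X \<Longrightarrow> norm (C z - 1) \<le> R" "\<And>z. z \<in> X \<Longrightarrow> norm (D z - 1) \<le> R"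
      "\<And>z. z \<in> X \<Longrightarrow> norm (E z - 1) \<le> R" "\<And>z. z \<in> X \<Longrightarrow> norm (F z - 1) \<le> R"
      "\<And>z. z \<in> X \<Longrightarrow> norm (G z - 1) \<le> R"
  shows "uniform_limit X (\<lambda>n z. \<Sum>k<n. F43_term (A z) (B z) (C z) (D z) (E z) (F z) (G z) k)
      (\<lambda>z. F43_reg (A z) (B z) (C z) (D z) (E z) (F z) (G z)) sequentially"
  unfolding F43_reg_altdef
proof (rule Weierstrass_m_test)
  show "norm (F43_term (A z) (B z) (C z) (D z) (E z) (F z) (G z) k) \<le> exp (R\<^sup>2 + 2 * R) ^ 7 * inverse (real (Suc k) ^ 2)"
    if "z \<in> X" for k z
    by (rule norm_F43_term_le[OF saal]) (rule that R)+
  show "summable (\<lambda>k. exp (R\<^sup>2 + 2 * R) ^ 7 * inverse (real (Suc k) ^ 2))"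
    by (rule summable_inverse_Suc_square)
qed

lemma holomorphic_bounded_on_cball:
  fixes f :: "complex \<Rightarrow> complex"
  assumes "f holomorphic_on UNIV"
  obtains r where "0 \<le> r" "\<And>z. z \<in> cball x 1 \<Longrightarrow> norm (f z - 1) \<le> r"
proof -
  have "continuous_on (cball x 1) f"
    using assms holomorphic_on_imp_continuous_on holomorphic_on_subset by blast
  then have "compact ((\<lambda>z. f z - 1) ` cball x 1)"
    by (intro compact_continuous_image continuous_intros compact_cball)
  then have "bounded ((\<lambda>z. f z - 1) ` cball x 1)" by (rule compact_imp_bounded)
  then obtain r where "\<And>z. z \<in> cball x 1 \<Longrightarrow> norm (f z - 1) \<le> r" unfolding bounded_iff by blast
  then show ?thesis by (intro that[of "max r 0"]) (simp_all add: le_max_iff_disj)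
qed

text \<open>The parameters are entire functions of one variable that satisfy the parameter condition
  identically, so one-variable theory suffices: on each closed unit ball they are bounded, and the
  partial sums converge uniformly there.\<close>

lemma holomorphic_F43_reg:
  assumes hol: "A holomorphic_on UNIV" "B holomorphic_on UNIV" "C holomorphic_on UNIV" "D holomorphic_on UNIV"
      "E holomorphic_on UNIV" "F holomorphic_on UNIV" "G holomorphic_on UNIV"
    and saal: "\<And>z. E z + F z + G z - A z - B z - C z - D z = 1"
  shows "(\<lambda>z. F43_reg (A z) (B z) (C z) (D z) (E z) (F z) (G z)) holomorphic_on UNIV"
proof -
  define t where "t = (\<lambda>n z. \<Sum>k<n. F43_term (A z) (B z) (C z) (D z) (E z) (F z) (G z) k)"
  define s where "s = (\<lambda>z. F43_reg (A z) (B z) (C z) (D z) (E z) (F z) (G z))"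
  have hol_t: "t n holomorphic_on UNIV" for n
    unfolding t_def F43_term_def divide_inverse by (intro holomorphic_intros hol)
  have lim: "uniform_limit (cball x 1) t s sequentially" for x
  proof -
    obtain r1 where r1: "0 \<le> r1" "\<And>z. z \<in> cball x 1 \<Longrightarrow> norm (A z - 1) \<le> r1"
      by (rule holomorphic_bounded_on_cball[OF hol(1)]) blast
    obtain r2 where r2: "0 \<le> r2" "\<And>z. z \<in> cball x 1 \<Longrightarrow> norm (B z - 1) \<le> r2"
      by (rule holomorphic_bounded_on_cball[OF hol(2)]) blast
    obtain r3 where r3: "0 \<le> r3" "\<And>z. z \<in> cball x 1 \<Longrightarrow> norm (C z - 1) \<le> r3"
      by (rule holomorphic_bounded_on_cball[OF hol(3)]) blast
    obtain r4 where r4: "0 \<le> r4" "\<And>z. z \<in> cball x 1 \<Longrightarrow> norm (D z - 1) \<le> r4"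
      by (rule holomorphic_bounded_on_cball[OF hol(4)]) blast
    obtain r5 where r5: "0 \<le> r5" "\<And>z. z \<in> cball x 1 \<Longrightarrow> norm (E z - 1) \<le> r5"
      by (rule holomorphic_bounded_on_cball[OF hol(5)]) blast
    obtain r6 where r6: "0 \<le> r6" "\<And>z. z \<in> cball x 1 \<Longrightarrow> norm (F z - 1) \<le> r6"
      by (rule holomorphic_bounded_on_cball[OF hol(6)]) blast
    obtain r7 where r7: "0 \<le> r7" "\<And>z. z \<in> cball x 1 \<Longrightarrow> norm (G z - 1) \<le> r7"
      by (rule holomorphic_bounded_on_cball[OF hol(7)]) blast
    define R where "R = r1 + r2 + r3 + r4 + r5 + r6 + r7"
    have R: "r1 \<le> R" "r2 \<le> R" "r3 \<le> R" "r4 \<le> R" "r5 \<le> R" "r6 \<le> R" "r7 \<le> R"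
      using r1(1) r2(1) r3(1) r4(1) r5(1) r6(1) r7(1) by (simp_all add: R_def)
    show ?thesis unfolding t_def s_def
      by (rule uniform_limit_F43_reg[where R = R])
        (rule saal r1(2)[THEN order_trans] r2(2)[THEN order_trans] r3(2)[THEN order_trans] r4(2)[THEN order_trans]
          r5(2)[THEN order_trans] r6(2)[THEN order_trans] r7(2)[THEN order_trans] R | assumption)+
  qed
  have "s holomorphic_on UNIV"
    by (rule holomorphic_uniform_sequence[of _ t]) (use hol_t lim in \<open>auto intro!: exI[of _ 1]\<close>)
  then show ?thesis by (simp only: s_def)
qed

section \<open>Partial fractions of the truncated Barnes integrand\<close>

text \<open>The quotients are the coefficients of the Lagrange interpolation polynomial
  \<open>q\<close> of \<open>p\<close> on \<open>X\<close>. Both have degree below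
  \<open>card X\<close>, so \<open>q = p\<close>; comparing coefficients of degree
  \<open>card X - 1\<close> gives the sum on one side and 0 on the other. This is the residue
  theorem for a rational function with simple poles, in algebraic form.\<close>

lemma lagrange_residue_sum:
  fixes p :: "'a :: field poly"
  assumes fin: "finite X" and card: "degree p + 2 \<le> card X"
  shows "(\<Sum>x\<in>X. poly p x / (\<Prod>y\<in>X - {x}. x - y)) = 0"
proof -
  define l where "l x = (\<Prod>y\<in>X - {x}. [:- y, 1:])" for x
  define c where "c x = poly p x / (\<Prod>y\<in>X - {x}. x - y)" for x
  define q where "q = (\<Sum>x\<in>X. smult (c x) (l x))"
  have deg_l: "degree (l x) = card X - 1" if "x \<in> X" for x
    using that fin unfolding l_def
    by (subst degree_prod_eq_sum_degree) (auto simp: card_Diff_singleton)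
  have lead_l: "coeff (l x) (card X - 1) = 1" if "x \<in> X" for x
  proof -
    have "lead_coeff (l x) = 1" unfolding l_def by (simp add: lead_coeff_prod)
    then show ?thesis using deg_l[OF that] by simp
  qed
  have poly_q: "poly q x = poly p x" if "x \<in> X" for x
  proof -
    have "poly q x = (\<Sum>z\<in>X. c z * (\<Prod>y\<in>X - {z}. x - y))"
      by (simp add: q_def l_def poly_sum poly_prod)
    also have "\<dots> = (\<Sum>z\<in>X. if z = x then poly p x else 0)"
    proof (intro sum.cong refl)
      fix z assume "z \<in> X"
      have "(\<Prod>y\<in>X - {z}. x - y) = 0" if "z \<noteq> x"
        using that \<open>x \<in> X\<close> fin by (intro prod_zero) auto
      moreover have "(\<Prod>y\<in>X - {x}. x - y) \<noteq> 0" using fin by auto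
      ultimately show "c z * (\<Prod>y\<in>X - {z}. x - y) = (if z = x then poly p x else 0)"
        by (auto simp: c_def)
    qed
    finally show ?thesis using that fin by simp
  qed
  have "degree q \<le> card X - 1"
    unfolding q_def using deg_l by (intro degree_sum_le fin) (metis degree_smult_le)
  then have "degree (q - p) < card X"
    using card by (intro le_less_trans[OF degree_diff_le_max]) auto
  then have "q - p = 0"
    using poly_q card_poly_roots_bound[of "q - p"] card_mono[OF poly_roots_finite[of "q - p"], of X]
    by (fastforce intro: ccontr)
  moreover have "coeff p (card X - 1) = 0" using card by (intro coeff_eq_0) auto
  ultimately have "coeff q (card X - 1) = 0" by simp
  moreover have "coeff q (card X - 1) = (\<Sum>x\<in>X. c x)"
    unfolding q_def coeff_sum by (intro sum.cong refl) (simp add: lead_l[simplified])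
  ultimately show ?thesis by (simp add: c_def)
qed

lemma pochhammer_shift:
  fixes z :: "'a :: field"
  assumes "pochhammer z k \<noteq> 0"
  shows "pochhammer (z + of_nat k) n = pochhammer z (n + k) / pochhammer z k"
  using assms by (simp add: pochhammer_product' add.commute)

lemma pochhammer_shift_neg:
  fixes z :: "'a :: comm_ring_1"
  assumes "k \<le> n"
  shows "pochhammer (z - of_nat k) n = (-1) ^ k * pochhammer (1 - z) k * pochhammer z (n - k)"
proof -
  have "pochhammer (z - of_nat k) n = pochhammer (z - of_nat k) k * pochhammer z (n - k)"
    using assms pochhammer_product[of k n "z - of_nat k"] by simp
  also have "pochhammer (z - of_nat k) k = (-1) ^ k * pochhammer (1 - z) k"
    using pochhammer_minus[of "of_nat k - z" k] by (simp add: algebra_simps)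
  finally show ?thesis by simp
qed

lemma prod_of_nat_diff:
  assumes "k \<le> m"
  shows "(\<Prod>j\<in>{..m} - {k}. of_nat j - of_nat k) = ((-1) ^ k * fact k * fact (m - k) :: 'a :: {comm_ring_1,semiring_char_0})"
proof -
  have "{..m} - {k} = {..<k} \<union> {k<..m}" using assms by auto
  then have "(\<Prod>j\<in>{..m} - {k}. of_nat j - of_nat k :: 'a) =
      (\<Prod>j<k. of_nat j - of_nat k) * (\<Prod>j\<in>{k<..m}. of_nat j - of_nat k)"
    by (metis (no_types, lifting) Int_emptyI finite_greaterThanAtMost finite_lessThan greaterThanAtMost_iff leD lessThan_iff less_imp_le_nat prod.union_disjoint)
  also have "(\<Prod>j<k. of_nat j - of_nat k :: 'a) = (\<Prod>j<k. (-1) * of_nat (Suc j))"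
    by (rule prod.reindex_bij_witness[of _ "\<lambda>j. k - Suc j" "\<lambda>j. k - Suc j"]) auto
  also have "\<dots> = (-1) ^ k * fact k"
    unfolding prod.distrib prod_constant
    by (simp add: fact_prod_Suc lessThan_atLeast0)
  also have "(\<Prod>j\<in>{k<..m}. of_nat j - of_nat k :: 'a) = (\<Prod>j<m - k. of_nat (Suc j))"
    by (rule prod.reindex_bij_witness[of _ "\<lambda>j. j + Suc k" "\<lambda>j. j - Suc k"]) auto
  also have "\<dots> = fact (m - k)" by (simp add: fact_prod_Suc lessThan_atLeast0)
  finally show ?thesis .
qed

text \<open>The truncation of the numerator of
  \<open>\<Gamma>(a+t) \<Gamma>(b+t) \<Gamma>(c+t) \<Gamma>(-t) / (\<Gamma>(e+t) \<Gamma>(f+t) \<Gamma>(g+t) \<Gamma>(1-d-t))\<close>.\<close>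

definition trunc_num :: "'a :: field \<Rightarrow> 'a \<Rightarrow> 'a \<Rightarrow> 'a \<Rightarrow> nat \<Rightarrow> 'a \<Rightarrow> 'a" where
  "trunc_num d e f g m t = pochhammer (e + t) m * pochhammer (f + t) m * pochhammer (g + t) m
     * pochhammer (1 - d - t) (m + 2)"

lemma ex_poly_pochhammer:
  fixes u v :: "'a :: field"
  shows "\<exists>p. degree p \<le> n \<and> (\<forall>t. poly p t = pochhammer (u + v * t) n)"
proof (intro exI conjI allI)
  let ?p = "\<Prod>i<n. [:u + of_nat i, v:]"
  have "degree ?p \<le> (\<Sum>i<n. degree [:u + of_nat i, v:])" by (rule degree_prod_sum_le[OF finite_lessThan, unfolded o_def])
  also have "\<dots> \<le> (\<Sum>i<n. 1)" by (intro sum_mono) simp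
  finally show "degree ?p \<le> n" by simp
  show "poly ?p t = pochhammer (u + v * t) n" for t
    by (simp add: poly_prod pochhammer_prod lessThan_atLeast0 algebra_simps)
qed

lemma ex_poly_trunc_num:
  fixes d e f g :: "'a :: field"
  obtains p where "degree p \<le> 4 * m + 2" "\<And>t. poly p t = trunc_num d e f g m t"
proof -
  obtain p1 where p1: "degree p1 \<le> m" "\<And>t. poly p1 t = pochhammer (e + 1 * t) m"
    using ex_poly_pochhammer by blast
  obtain p2 where p2: "degree p2 \<le> m" "\<And>t. poly p2 t = pochhammer (f + 1 * t) m"
    using ex_poly_pochhammer by blast
  obtain p3 where p3: "degree p3 \<le> m" "\<And>t. poly p3 t = pochhammer (g + 1 * t) m"
    using ex_poly_pochhammer by blast
  obtain p4 where p4: "degree p4 \<le> m + 2" "\<And>t. poly p4 t = pochhammer (1 - d + (-1) * t) (m + 2)"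
    using ex_poly_pochhammer by blast
  show ?thesis
  proof (rule that)
    show "degree (p1 * p2 * p3 * p4) \<le> 4 * m + 2"
      using p1(1) p2(1) p3(1) p4(1) degree_mult_le[of "p1 * p2 * p3" p4]
        degree_mult_le[of "p1 * p2" p3] degree_mult_le[of p1 p2] by linarith
    show "poly (p1 * p2 * p3 * p4) t = trunc_num d e f g m t" for t
      by (simp add: trunc_num_def p1 p2 p3 p4)
  qed
qed

section \<open>Poles and residues of the truncated integrand\<close>

definition left_poles :: "complex \<Rightarrow> nat \<Rightarrow> complex set" where
  "left_poles u m = (\<lambda>k. - u - of_nat k) ` {..m}"

definition right_poles :: "nat \<Rightarrow> complex set" where
  "right_poles m = of_nat ` {..m}"

lemma card_poles [simp]: "card (left_poles u m) = Suc m" "card (right_poles m) = Suc m"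
  by (simp_all add: left_poles_def right_poles_def card_image inj_on_def)

lemma finite_poles [simp]: "finite (left_poles u m)" "finite (right_poles m)"
  by (simp_all add: left_poles_def right_poles_def)

lemma left_poles_disjoint:
  assumes "u - v \<notin> \<int>"
  shows "left_poles u m \<inter> left_poles v m = {}"
proof (rule ccontr)
  assume "left_poles u m \<inter> left_poles v m \<noteq> {}"
  then obtain j k where "- u - of_nat j = - v - of_nat k" by (auto simp: left_poles_def)
  then have "u - v = of_nat k - of_nat j" by (simp add: algebra_simps)
  then show False using assms by auto
qed

lemma left_right_poles_disjoint:
  assumes "u \<notin> \<int>"
  shows "left_poles u m \<inter> right_poles m = {}"
proof (rule ccontr)
  assume "left_poles u m \<inter> right_poles m \<noteq> {}"
  then obtain j k where "- u - of_nat j = (of_nat k :: complex)" by (auto simp: left_poles_def right_poles_def)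
  then have "u = - of_nat k - of_nat j" by (metis (no_types) add_uminus_conv_diff add.commute diff_eq_eq minus_diff_eq minus_minus)
  then show False using assms by auto
qed

lemma prod_left_poles: "(\<Prod>y\<in>left_poles u m. x - y) = pochhammer (u + x) (m + 1)"
  unfolding left_poles_def
  by (subst prod.reindex) (auto simp: inj_on_def pochhammer_prod atLeast0AtMost lessThan_Suc_atMost lessThan_atLeast0 [symmetric] algebra_simps)

lemma prod_right_poles: "(\<Prod>y\<in>right_poles m. x - y) = (-1) ^ (m + 1) * pochhammer (- x) (m + 1)"
proof -
  have "(\<Prod>y\<in>right_poles m. x - y) = (\<Prod>j\<le>m. (-1) * (- x + of_nat j))"
    unfolding right_poles_def by (subst prod.reindex) (auto simp: inj_on_def)
  also have "\<dots> = (-1) ^ (m + 1) * pochhammer (- x) (m + 1)"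
    unfolding prod.distrib prod_constant
    by (simp add: pochhammer_prod lessThan_Suc_atMost lessThan_atLeast0 [symmetric])
  finally show ?thesis .
qed

lemma prod_left_poles_diff:
  assumes "k \<le> m"
  shows "(\<Prod>y\<in>left_poles u m - {- u - of_nat k}. - u - of_nat k - y) = (-1) ^ k * fact k * fact (m - k)"
proof -
  have "left_poles u m - {- u - of_nat k} = (\<lambda>k. - u - of_nat k) ` ({..m} - {k})"
    by (auto simp: left_poles_def)
  then have "(\<Prod>y\<in>left_poles u m - {- u - of_nat k}. - u - of_nat k - y) = (\<Prod>j\<in>{..m} - {k}. of_nat j - of_nat k)"
    by (simp only:) (subst prod.reindex; simp add: inj_on_def)
  then show ?thesis using prod_of_nat_diff[OF assms] by simp
qed

lemma prod_right_poles_diff: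
  assumes "k \<le> m"
  shows "(\<Prod>y\<in>right_poles m - {of_nat k}. of_nat k - y) = (-1) ^ m * ((-1) ^ k * fact k * fact (m - k))"
proof -
  have "right_poles m - {of_nat k} = of_nat ` ({..m} - {k})"
    by (auto simp: right_poles_def)
  then have "(\<Prod>y\<in>right_poles m - {of_nat k}. of_nat k - y) = (\<Prod>j\<in>{..m} - {k}. (-1) * (of_nat j - of_nat k))"
    by (simp only:) (subst prod.reindex; simp add: inj_on_def)
  also have "\<dots> = (-1) ^ m * (\<Prod>j\<in>{..m} - {k}. of_nat j - of_nat k)"
    unfolding prod.distrib prod_constant using assms by simp
  finally show ?thesis using prod_of_nat_diff[OF assms] by simp
qed

lemma sum_left_poles: "(\<Sum>x\<in>left_poles u m. h x) = (\<Sum>k\<le>m. h (- u - of_nat k))"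
  unfolding left_poles_def by (subst sum.reindex) (auto simp: inj_on_def)

lemma sum_right_poles: "(\<Sum>x\<in>right_poles m. h x) = (\<Sum>k\<le>m. h (of_nat k))"
  unfolding right_poles_def by (subst sum.reindex) (auto simp: inj_on_def)

definition hyp_coeff :: "complex \<Rightarrow> complex \<Rightarrow> complex \<Rightarrow> complex \<Rightarrow> complex \<Rightarrow> complex \<Rightarrow> complex \<Rightarrow> nat \<Rightarrow> complex" where
  "hyp_coeff A B C D E F G k = pochhammer A k * pochhammer B k * pochhammer C k * pochhammer D k
     / (fact k * pochhammer E k * pochhammer F k * pochhammer G k)"

text \<open>The residues are factored so that \<open>m\<close> enters only through
  \<open>m + k\<close> ("up") and \<open>m - k\<close> ("down"). For both kinds of poles the sums
  then have the shape \<open>t k * (u (m + k) * v (m - k))\<close>, and one limit lemma treats them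
  all.\<close>

definition right_up :: "complex \<Rightarrow> complex \<Rightarrow> complex \<Rightarrow> complex \<Rightarrow> complex \<Rightarrow> complex \<Rightarrow> nat \<Rightarrow> complex" where
  "right_up a b c e f g n = pochhammer e n * pochhammer f n * pochhammer g n
     / (pochhammer a (n + 1) * pochhammer b (n + 1) * pochhammer c (n + 1))"

definition right_down :: "complex \<Rightarrow> nat \<Rightarrow> complex" where
  "right_down d n = pochhammer (1 - d) (n + 2) / fact n"

definition left_up :: "complex \<Rightarrow> complex \<Rightarrow> nat \<Rightarrow> complex" where
  "left_up a d n = pochhammer (1 + a - d) (n + 2) / pochhammer a (n + 1)"

definition left_down :: "complex \<Rightarrow> complex \<Rightarrow> complex \<Rightarrow> complex \<Rightarrow> complex \<Rightarrow> complex \<Rightarrow> nat \<Rightarrow> complex" where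
  "left_down a b c e f g n = pochhammer (e - a) n * pochhammer (f - a) n * pochhammer (g - a) n
     / (pochhammer (b - a) (n + 1) * pochhammer (c - a) (n + 1) * fact n)"

lemma pochhammer_nonzero:
  assumes "(z :: complex) \<notin> \<int>"
  shows "pochhammer z n \<noteq> 0"
  using assms by (auto simp: pochhammer_eq_0_iff)

text \<open>All Pochhammer symbols are shifted forward by \<open>k\<close> except the one of
  \<open>1 - d - k\<close>, whose first \<open>k\<close> factors are reversed. This reversal creates
  the fourth upper parameter \<open>d\<close>.\<close>

lemma right_residue:
  fixes a b c d e f g :: complex
  assumes k: "k \<le> m" and nonint: "a \<notin> \<int>" "b \<notin> \<int>" "c \<notin> \<int>" "e \<notin> \<int>" "f \<notin> \<int>" "g \<notin> \<int>"
  shows "trunc_num d e f g m (of_nat k) /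
     (pochhammer (a + of_nat k) (m + 1) * pochhammer (b + of_nat k) (m + 1) * pochhammer (c + of_nat k) (m + 1)
       * ((-1) ^ m * ((-1) ^ k * fact k * fact (m - k))))
    = (-1) ^ m * (hyp_coeff a b c d e f g k * (right_up a b c e f g (m + k) * right_down d (m - k)))"
proof -
  have sh: "pochhammer (u + of_nat k) n = pochhammer u (n + k) / pochhammer u k" if "u \<notin> \<int>" for u :: complex and n
    by (rule pochhammer_shift[OF pochhammer_nonzero[OF that]])
  have "pochhammer (1 - d - of_nat k) (m + 2) = (-1) ^ k * pochhammer d k * pochhammer (1 - d) (m - k + 2)"
    using k by (subst pochhammer_shift_neg) (auto simp: Suc_diff_le)
  then show ?thesis
    unfolding trunc_num_def hyp_coeff_def right_up_def right_down_def sh[OF nonint(1)] sh[OF nonint(2)]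
      sh[OF nonint(3)] sh[OF nonint(4)] sh[OF nonint(5)] sh[OF nonint(6)]
    by (simp only: divide_inverse inverse_mult_distrib inverse_inverse_eq power_inverse [symmetric] inverse_minus_eq inverse_1 mult_ac add_ac) 
      (simp add: power_mult_distrib[symmetric] mult_ac)
qed

text \<open>At \<open>-a - k\<close> the roles are exchanged: the symbols of
  \<open>e, f, g, b, c\<close> are reversed and produce \<open>1 + a - e\<close> and so on, while
  those of \<open>1 - d - t\<close> and \<open>-t\<close> are shifted forward.\<close>

lemma left_residue:
  fixes a b c d e f g :: complex
  assumes k: "k \<le> m" and nonint: "a \<notin> \<int>" "a - d \<notin> \<int>"
  shows "trunc_num d e f g m (- a - of_nat k) /
     (((-1) ^ k * fact k * fact (m - k)) * pochhammer (b + (- a - of_nat k)) (m + 1)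
       * pochhammer (c + (- a - of_nat k)) (m + 1) * ((-1) ^ (m + 1) * pochhammer (- (- a - of_nat k)) (m + 1)))
    = (-1) ^ (m + 1) * (hyp_coeff a (1 + a - e) (1 + a - f) (1 + a - g) (1 + a - b) (1 + a - c) (1 + a - d) k
        * (left_up a d (m + k) * left_down a b c e f g (m - k)))"
proof -
  have neg: "pochhammer (u + (- a - of_nat k)) n = (-1) ^ k * pochhammer (1 + a - u) k * pochhammer (u - a) (n - k)"
    if "k \<le> n" for u n
    using pochhammer_shift_neg[OF that, of "u - a"] by (simp add: algebra_simps)
  have neg': "pochhammer (u + (- a - of_nat k)) (m + 1) = (-1) ^ k * pochhammer (1 + a - u) k * pochhammer (u - a) (m - k + 1)" for u
    using neg[of "m + 1" u] k by (simp add: Suc_diff_le)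
  have 1: "pochhammer (- (- a - of_nat k)) (m + 1) = pochhammer a (m + k + 1) / pochhammer a k"
    using pochhammer_shift[OF pochhammer_nonzero[OF nonint(1)], of k "m + 1"] by (simp add: add_ac)
  have "1 + a - d \<notin> \<int>"
  proof
    assume "1 + a - d \<in> \<int>"
    then have "(1 + a - d) - 1 \<in> \<int>" by (rule Ints_diff) simp
    with nonint(2) show False by simp
  qed
  then have 2: "pochhammer (1 - d - (- a - of_nat k)) (m + 2) = pochhammer (1 + a - d) (m + k + 2) / pochhammer (1 + a - d) k"
    using pochhammer_shift[OF pochhammer_nonzero, of "1 + a - d" k "m + 2"] by (simp add: algebra_simps)
  \<comment> \<open>Here \<open>s\<close> is \<open>(-1)^k\<close> and \<open>t\<close> is
    \<open>(-1)^(m+1)\<close>. Three reversals in the numerator meet two reversals and one sign from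
    the distances between the poles in the denominator, so all powers of \<open>s\<close>
    cancel.\<close>
  have alg: "s * x1 * x1' * (s * x2 * x2') * (s * x3 * x3') * (x4 / y4') / (s * fk * fmk * (s * y1 * y1') * (s * y2 * y2') * (t * (x5 / x4')))
     = t * (x4' * x1 * x2 * x3 / (fk * y1 * y2 * y4') * (x4 / x5 * (x1' * x2' * x3' / (y1' * y2' * fmk))))"
    if "s = 1 \<or> s = -1" "t = 1 \<or> t = -1"
    for s t x1 x1' x2 x2' x3 x3' x4 x4' x5 y1 y1' y2 y2' y4' fk fmk :: complex
    using that by (auto simp add: divide_inverse mult_ac)
  show ?thesis
    unfolding trunc_num_def neg[OF order_refl] neg[OF k] neg' 1 2 hyp_coeff_def left_up_def left_down_def
    by (rule alg) (auto simp: minus_one_power_iff)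
qed

text \<open>The numerator has degree at most \<open>4 * m + 2\<close> and there are
  \<open>4 * (m + 1)\<close> poles, distinct by the non-integrality assumptions, so the bound of the
  residue lemma is met with equality. Left residues carry the sign \<open>(-1)^(m+1)\<close> and
  right ones \<open>(-1)^m\<close>, which puts them on opposite sides.\<close>

lemma trunc_relation:
  fixes a b c d e f g :: complex
  assumes nonint: "a \<notin> \<int>" "b \<notin> \<int>" "c \<notin> \<int>" "e \<notin> \<int>" "f \<notin> \<int>" "g \<notin> \<int>"
      "a - d \<notin> \<int>" "b - d \<notin> \<int>" "c - d \<notin> \<int>" "a - b \<notin> \<int>" "b - c \<notin> \<int>" "a - c \<notin> \<int>"
  shows "(\<Sum>k\<le>m. hyp_coeff a b c d e f g k * (right_up a b c e f g (m + k) * right_down d (m - k))) =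
    (\<Sum>k\<le>m. hyp_coeff a (1 + a - e) (1 + a - f) (1 + a - g) (1 + a - b) (1 + a - c) (1 + a - d) k
        * (left_up a d (m + k) * left_down a b c e f g (m - k))) +
    (\<Sum>k\<le>m. hyp_coeff b (1 + b - e) (1 + b - f) (1 + b - g) (1 + b - c) (1 + b - a) (1 + b - d) k
        * (left_up b d (m + k) * left_down b c a e f g (m - k))) +
    (\<Sum>k\<le>m. hyp_coeff c (1 + c - e) (1 + c - f) (1 + c - g) (1 + c - a) (1 + c - b) (1 + c - d) k
        * (left_up c d (m + k) * left_down c a b e f g (m - k)))"
proof -
  obtain p where p: "degree p \<le> 4 * m + 2" "\<And>t. poly p t = trunc_num d e f g m t"
    using ex_poly_trunc_num[of m d e f g] by blast
  let ?N = "trunc_num d e f g m"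
  let ?A = "left_poles a m" let ?B = "left_poles b m" let ?C = "left_poles c m" let ?Z = "right_poles m"
  let ?X = "?A \<union> ?B \<union> ?C \<union> ?Z"
  have swap: "v - u \<notin> \<int>" if "u - v \<notin> \<int>" for u v :: complex
    using that by (metis Ints_minus minus_diff_eq)
  have disj: "?A \<inter> ?B = {}" "?B \<inter> ?C = {}" "?A \<inter> ?C = {}" "?A \<inter> ?Z = {}" "?B \<inter> ?Z = {}" "?C \<inter> ?Z = {}"
    by (intro left_poles_disjoint left_right_poles_disjoint nonint)+
  have split: "(\<Prod>y\<in>P \<union> Q \<union> R \<union> T - {x}. x - y) =
      (\<Prod>y\<in>P - {x}. x - y) * (\<Prod>y\<in>Q. x - y) * (\<Prod>y\<in>R. x - y) * (\<Prod>y\<in>T. x - y)"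
    if "x \<in> P" "finite P" "finite Q" "finite R" "finite T" "P \<inter> Q = {}" "P \<inter> R = {}" "P \<inter> T = {}"
       "Q \<inter> R = {}" "Q \<inter> T = {}" "R \<inter> T = {}"
    for P Q R T :: "complex set" and x
  proof -
    from that have *: "P \<union> Q \<union> R \<union> T - {x} = (P - {x}) \<union> Q \<union> R \<union> T" by blast
    have d: "(P - {x}) \<inter> Q = {}" "((P - {x}) \<union> Q) \<inter> R = {}" "((P - {x}) \<union> Q \<union> R) \<inter> T = {}"
      using that by blast+
    show ?thesis
      unfolding * using that d by (simp add: prod.union_disjoint)
  qed
  have card: "card ?X = 4 * (m + 1)"
    using disj by (simp add: card_Un_disjoint Int_Un_distrib2)
  \<comment> \<open>Formulated for \<open>u, v, w\<close> with the pole set written in a matching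
    order, so that one computation serves all three families.\<close>
  have left: "(\<Sum>x\<in>left_poles u m. ?N x / (\<Prod>y\<in>?X - {x}. x - y)) =
     (-1) ^ (m + 1) * (\<Sum>k\<le>m. hyp_coeff u (1 + u - e) (1 + u - f) (1 + u - g) (1 + u - v) (1 + u - w) (1 + u - d) k
        * (left_up u d (m + k) * left_down u v w e f g (m - k)))"
    if X: "?X = left_poles u m \<union> left_poles v m \<union> left_poles w m \<union> ?Z"
      and ni: "u \<notin> \<int>" "v \<notin> \<int>" "w \<notin> \<int>" "u - v \<notin> \<int>" "u - w \<notin> \<int>" "v - w \<notin> \<int>" "u - d \<notin> \<int>" for u v w
  proof -
    have "?N x / (\<Prod>y\<in>?X - {x}. x - y) = (-1) ^ (m + 1) *
        (hyp_coeff u (1 + u - e) (1 + u - f) (1 + u - g) (1 + u - v) (1 + u - w) (1 + u - d) k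
        * (left_up u d (m + k) * left_down u v w e f g (m - k)))" if "x = - u - of_nat k" "k \<le> m" for x k
    proof -
      have x: "x \<in> left_poles u m" using that by (auto simp: left_poles_def)
      have pr: "(\<Prod>y\<in>?X - {x}. x - y) =
        (\<Prod>y\<in>left_poles u m - {x}. x - y) * (\<Prod>y\<in>left_poles v m. x - y) * (\<Prod>y\<in>left_poles w m. x - y) * (\<Prod>y\<in>?Z. x - y)"
        unfolding X by (rule split[OF x]) (intro finite_poles left_poles_disjoint left_right_poles_disjoint ni)+
      show ?thesis
        unfolding pr unfolding that(1) prod_left_poles_diff[OF that(2)] prod_left_poles prod_right_poles
        by (rule left_residue[OF that(2) ni(1) ni(7)])
    qed
    then show ?thesis unfolding sum_left_poles sum_distrib_left by (intro sum.cong refl) simp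
  qed
  have right: "(\<Sum>x\<in>?Z. ?N x / (\<Prod>y\<in>?X - {x}. x - y)) =
     (-1) ^ m * (\<Sum>k\<le>m. hyp_coeff a b c d e f g k * (right_up a b c e f g (m + k) * right_down d (m - k)))"
  proof -
    have "?N x / (\<Prod>y\<in>?X - {x}. x - y) = (-1) ^ m *
        (hyp_coeff a b c d e f g k * (right_up a b c e f g (m + k) * right_down d (m - k)))" if "x = of_nat k" "k \<le> m" for x k
    proof -
      have x: "x \<in> ?Z" using that by (auto simp: right_poles_def)
      have X: "?X = ?Z \<union> ?A \<union> ?B \<union> ?C" by blast
      have "(\<Prod>y\<in>?X - {x}. x - y) =
        (\<Prod>y\<in>?Z - {x}. x - y) * (\<Prod>y\<in>?A. x - y) * (\<Prod>y\<in>?B. x - y) * (\<Prod>y\<in>?C. x - y)"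
        unfolding X by (rule split[OF x]) (use disj in auto)
      then show ?thesis
        unfolding that(1) prod_right_poles_diff[OF that(2)] prod_left_poles
        using right_residue[OF that(2) nonint(1-6)] by (simp add: mult_ac)
    qed
    then show ?thesis unfolding sum_right_poles sum_distrib_left by (intro sum.cong refl) simp
  qed
  have "0 = (\<Sum>x\<in>?X. ?N x / (\<Prod>y\<in>?X - {x}. x - y))"
    using lagrange_residue_sum[of ?X p] card p by simp
  also have "\<dots> = (\<Sum>x\<in>?A. ?N x / (\<Prod>y\<in>?X - {x}. x - y)) + (\<Sum>x\<in>?B. ?N x / (\<Prod>y\<in>?X - {x}. x - y))
     + (\<Sum>x\<in>?C. ?N x / (\<Prod>y\<in>?X - {x}. x - y)) + (\<Sum>x\<in>?Z. ?N x / (\<Prod>y\<in>?X - {x}. x - y))"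
  proof -
    have d: "?A \<inter> ?B = {}" "(?A \<union> ?B) \<inter> ?C = {}" "(?A \<union> ?B \<union> ?C) \<inter> ?Z = {}" using disj by blast+
    have "sum h ?X = sum h ?A + sum h ?B + sum h ?C + sum h ?Z" for h :: "complex \<Rightarrow> complex"
      using d by (simp add: sum.union_disjoint)
    then show ?thesis .
  qed
  finally have main: "0 = \<dots>" .
  have XB: "?X = ?B \<union> ?C \<union> ?A \<union> ?Z" and XC: "?X = ?C \<union> ?A \<union> ?B \<union> ?Z" by blast+
  note main = main[unfolded right left[OF refl nonint(1,2,3,10,12,11,7)]
     left[OF XB nonint(2,3,1,11) swap[OF nonint(10)] swap[OF nonint(12)] nonint(8)]
     left[OF XC nonint(3,1,2) swap[OF nonint(12)] swap[OF nonint(11)] nonint(10) nonint(9)]]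
  have "r = x + y + z" if "0 = (-1) ^ (m + 1) * x + (-1) ^ (m + 1) * y + (-1) ^ (m + 1) * z + (-1) ^ m * r" for x y z r :: complex
  proof -
    from that have "0 = (-1) ^ m * (r - (x + y + z))" by (simp add: algebra_simps)
    then show ?thesis by simp
  qed
  from this[OF main] show ?thesis .
qed

section \<open>Passage to the limit\<close>

text \<open>Since \<open>w\<close> is purely imaginary, \<open>((m - k) / (m + k))\<^sup>w\<close> has modulus \<open>1\<close>, so the terms are
  dominated by a constant multiple of \<open>|t\<^sub>k|\<close>. This is why \<open>Re d = 2\<close> is assumed below.\<close>

lemma tendsto_sum_up_down:
  fixes t u v :: "nat \<Rightarrow> complex"
  assumes w: "Re w = 0" and summable: "summable (\<lambda>k. norm (t k))"
    and u: "(\<lambda>n. u n * exp (w * of_real (ln (real n)))) \<longlonglongrightarrow> \<beta>"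
    and v: "(\<lambda>n. v n * exp (- w * of_real (ln (real n)))) \<longlonglongrightarrow> \<gamma>"
  shows "(\<lambda>m. \<Sum>k\<le>m. t k * (u (m + k) * v (m - k))) \<longlonglongrightarrow> \<beta> * \<gamma> * (\<Sum>k. t k)"
proof -
  define U where "U n = u n * exp (w * of_real (ln (real n)))" for n
  define V' where "V' n = v n * exp (- w * of_real (ln (real n)))" for n
  define r where "r k m = exp (w * of_real (ln (real (m - k)) - ln (real (m + k))))" for k m
  have U: "U \<longlonglongrightarrow> \<beta>" using u unfolding U_def .
  have V': "V' \<longlonglongrightarrow> \<gamma>" using v unfolding V'_def .
  have eq: "u (m + k) * v (m - k) = U (m + k) * V' (m - k) * r k m" for m k
    by (simp add: U_def V'_def r_def mult_exp_exp algebra_simps)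
  have norm_r: "norm (r k m) = 1" for k m
    by (simp add: r_def w)
  obtain Bu where Bu: "\<And>n. norm (U n) \<le> Bu"
    using convergent_imp_Bseq[OF convergentI[OF U]] by (auto elim!: BseqE)
  obtain Bv where Bv: "\<And>n. norm (V' n) \<le> Bv"
    using convergent_imp_Bseq[OF convergentI[OF V']] by (auto elim!: BseqE)
  \<comment> \<open>Extension by 0 beyond \<open>k = m\<close> turns the finite sums into series
    over all \<open>k\<close>, the setting of Tannery's theorem.\<close>
  define a where "a k m = (if k \<le> m then t k * (u (m + k) * v (m - k)) else 0)" for k m
  have lim: "(\<lambda>m. a k m) \<longlonglongrightarrow> t k * (\<beta> * \<gamma>)" for k
  proof -
    have 1: "(\<lambda>m. U (m + k)) \<longlonglongrightarrow> \<beta>" using U by (rule LIMSEQ_ignore_initial_segment)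
    have 2: "(\<lambda>m. V' (m - k)) \<longlonglongrightarrow> \<gamma>" using V' filterlim_minus_const_nat_at_top filterlim_compose by blast
    have "(\<lambda>m. ln (real m - real k) - ln (real m + real k)) \<longlonglongrightarrow> 0" by real_asymp
    moreover have "eventually (\<lambda>m. ln (real m - real k) - ln (real m + real k) = ln (real (m - k)) - ln (real (m + k))) sequentially"
      using eventually_ge_at_top[of k] by eventually_elim simp
    ultimately have 3: "(\<lambda>m. ln (real (m - k)) - ln (real (m + k))) \<longlonglongrightarrow> 0"
      by (rule Lim_transform_eventually)
    have 4: "r k \<longlonglongrightarrow> exp (w * of_real 0)" unfolding r_def by (intro tendsto_intros 3)
    have "(\<lambda>m. t k * (U (m + k) * V' (m - k) * r k m)) \<longlonglongrightarrow> t k * (\<beta> * \<gamma> * exp (w * of_real 0))"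
      by (intro tendsto_mult tendsto_const 1 2 4)
    moreover have "eventually (\<lambda>m. t k * (U (m + k) * V' (m - k) * r k m) = a k m) sequentially"
      using eventually_ge_at_top[of k] by eventually_elim (simp add: a_def eq)
    ultimately show ?thesis by (auto intro: Lim_transform_eventually)
  qed
  have bound: "norm (a k m) \<le> norm (t k) * (Bu * Bv)" for k m
  proof (cases "k \<le> m")
    case True
    have "norm (U (m + k)) * norm (V' (m - k)) \<le> Bu * Bv"
      using Bu Bv by (intro mult_mono) (auto intro: order_trans[OF norm_ge_zero])
    then show ?thesis using True by (simp add: a_def eq norm_mult norm_r mult_left_mono)
  next
    case False
    have "0 \<le> Bu" "0 \<le> Bv" using Bu Bv norm_ge_zero order_trans by blast+
    then show ?thesis using False by (simp add: a_def)
  qed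
  have "(\<lambda>m. \<Sum>k. a k m) \<longlonglongrightarrow> (\<Sum>k. t k * (\<beta> * \<gamma>))"
  proof -
    have "eventually (\<lambda>(k, m). norm (a k m) \<le> norm (t k) * (Bu * Bv)) (at_top \<times>\<^sub>F sequentially)"
      using bound by (intro always_eventually) auto
    from tannerys_theorem[OF lim this summable_mult2[OF summable]] show ?thesis by simp
  qed
  moreover have "(\<Sum>k. a k m) = (\<Sum>k\<le>m. t k * (u (m + k) * v (m - k)))" for m
    by (subst suminf_finite[of "{..m}"]) (auto simp: a_def)
  moreover have "(\<Sum>k. t k * (\<beta> * \<gamma>)) = \<beta> * \<gamma> * (\<Sum>k. t k)"
    using suminf_mult2[OF summable_norm_cancel[OF summable], of "\<beta> * \<gamma>"] by (simp add: mult.commute)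
  ultimately show ?thesis by simp
qed

section \<open>Asymptotics of the up and down factors\<close>

lemma tendsto_pochhammer_Suc:
  fixes z :: complex
  shows "(\<lambda>n. pochhammer z (n + 1) / (fact n * exp (z * of_real (ln (real n))))) \<longlonglongrightarrow> rGamma z"
  using rGamma_series_LIMSEQ[of z] unfolding rGamma_series_def [abs_def] by (simp only: of_real_of_nat_eq)

lemma tendsto_div_add_const: "(\<lambda>n. of_nat n / (z + of_nat n)) \<longlonglongrightarrow> (1 :: complex)"
proof -
  have "(\<lambda>n. 1 / (z / of_nat n + 1)) \<longlonglongrightarrow> 1 / (0 + 1 :: complex)"
    by (intro tendsto_intros lim_const_over_n) auto
  moreover have "eventually (\<lambda>n. 1 / (z / of_nat n + 1) = of_nat n / (z + of_nat n)) sequentially"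
    using eventually_gt_at_top[of 0] by eventually_elim (simp add: field_simps)
  ultimately show ?thesis using Lim_transform_eventually by fastforce
qed

lemma tendsto_pochhammer:
  fixes z :: complex
  assumes "z \<notin> \<int>"
  shows "(\<lambda>n. pochhammer z n * of_nat n / (fact n * exp (z * of_real (ln (real n))))) \<longlonglongrightarrow> rGamma z"
proof -
  have "z + of_nat n \<noteq> 0" for n
    using assms by (metis Ints_minus Ints_of_nat add_eq_0_iff minus_minus)
  then have "pochhammer z (n + 1) / (fact n * exp (z * of_real (ln (real n)))) * (of_nat n / (z + of_nat n))
      = pochhammer z n * of_nat n / (fact n * exp (z * of_real (ln (real n))))" for n
    by (simp add: pochhammer_Suc)
  then show ?thesis
    using tendsto_mult[OF tendsto_pochhammer_Suc[of z] tendsto_div_add_const[of z]] by simp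
qed

lemma tendsto_pochhammer_Suc_Suc:
  fixes z :: complex
  shows "(\<lambda>n. pochhammer z (n + 2) / (fact n * of_nat n * exp (z * of_real (ln (real n))))) \<longlonglongrightarrow> rGamma z"
proof -
  have "(\<lambda>n. (z + 1) / of_nat n + 1) \<longlonglongrightarrow> 0 + 1"
    by (intro tendsto_intros lim_const_over_n)
  from tendsto_mult[OF tendsto_pochhammer_Suc[of z] this]
  have "(\<lambda>n. pochhammer z (n + 1) / (fact n * exp (z * of_real (ln (real n)))) * ((z + 1) / of_nat n + 1)) \<longlonglongrightarrow> rGamma z"
    by simp
  moreover have "eventually (\<lambda>n. pochhammer z (n + 1) / (fact n * exp (z * of_real (ln (real n)))) * ((z + 1) / of_nat n + 1)
      = pochhammer z (n + 2) / (fact n * of_nat n * exp (z * of_real (ln (real n))))) sequentially"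
    using eventually_gt_at_top[of 0]
    by eventually_elim (simp add: pochhammer_Suc field_simps)
  ultimately show ?thesis by (rule Lim_transform_eventually)
qed

lemma rGamma_nonzero: "(z :: complex) \<notin> \<int> \<Longrightarrow> rGamma z \<noteq> 0"
  by (auto simp: rGamma_eq_zero_iff)

text \<open>At \<open>n = 0\<close> the convention \<open>ln 0 = 0\<close> would give 1, so the
  power identities below are established only for eventually all \<open>n\<close>.\<close>

lemma exp_ln_of_nat: "n > 0 \<Longrightarrow> exp (complex_of_real (ln (real n))) = of_nat n"
  unfolding exp_of_real by simp

text \<open>Each symbol of length \<open>n\<close> below a symbol of length \<open>n + 1\<close>
  costs one power of \<open>n\<close>. The total exponent is
  \<open>e + f + g - a - b - c - 3\<close>, which is \<open>d - 2\<close> by the parameter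
  condition.\<close>

lemma tendsto_right_up:
  assumes nonint: "a \<notin> \<int>" "b \<notin> \<int>" "c \<notin> \<int>" "e \<notin> \<int>" "f \<notin> \<int>" "g \<notin> \<int>"
    and saal: "e + f + g - a - b - c - d = 1"
  shows "(\<lambda>n. right_up a b c e f g n * exp ((2 - d) * of_real (ln (real n)))) \<longlonglongrightarrow>
     rGamma e * rGamma f * rGamma g / (rGamma a * rGamma b * rGamma c)"
proof (rule Lim_transform_eventually)
  let ?X = "\<lambda>z n. exp (z * of_real (ln (real n))) :: complex"
  let ?T = "\<lambda>z n. pochhammer z (n + 1) / (fact n * ?X z n)"
  let ?U = "\<lambda>z n. pochhammer z n * of_nat n / (fact n * ?X z n)"
  show "(\<lambda>n. ?U e n * ?U f n * ?U g n / (?T a n * ?T b n * ?T c n)) \<longlonglongrightarrow>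
     rGamma e * rGamma f * rGamma g / (rGamma a * rGamma b * rGamma c)"
    by (intro tendsto_divide tendsto_mult tendsto_pochhammer tendsto_pochhammer_Suc nonint)
      (simp add: rGamma_nonzero nonint)
  show "eventually (\<lambda>n. ?U e n * ?U f n * ?U g n / (?T a n * ?T b n * ?T c n)
      = right_up a b c e f g n * exp ((2 - d) * of_real (ln (real n)))) sequentially"
    using eventually_gt_at_top[of 0]
  proof eventually_elim
    case (elim n)
    define L where "L = complex_of_real (ln (real n))"
    have "2 - d = 1 + 1 + 1 + a + b + c - e - f - g" using saal by (simp add: algebra_simps)
    then have X: "exp ((2 - d) * L) = of_nat n * of_nat n * of_nat n * exp (a * L) * exp (b * L) * exp (c * L)
        / exp (e * L) / exp (f * L) / exp (g * L)"
      using exp_ln_of_nat[OF elim] unfolding L_def [symmetric]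
      by (simp only: ring_distribs exp_add exp_diff mult_1)
    have alg: "(pe * N / (q * xe)) * (pf * N / (q * xf)) * (pg * N / (q * xg)) / ((pa / (q * xa)) * (pb / (q * xb)) * (pc / (q * xc)))
       = pe * pf * pg / (pa * pb * pc) * (N * N * N * xa * xb * xc / xe / xf / xg)"
      if "q \<noteq> 0" "pa \<noteq> 0" "pb \<noteq> 0" "pc \<noteq> 0" "xe \<noteq> 0" "xf \<noteq> 0" "xg \<noteq> 0" "xa \<noteq> 0" "xb \<noteq> 0" "xc \<noteq> 0"
      for pe pf pg pa pb pc N q xa xb xc xe xf xg :: complex
      using that by (simp add: field_simps)
    show ?case
      unfolding right_up_def X[unfolded L_def]
      by (rule alg) (simp_all add: pochhammer_nonzero nonint)
  qed
qed

lemma tendsto_right_down: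
  "(\<lambda>n. right_down d n * exp (- (2 - d) * of_real (ln (real n)))) \<longlonglongrightarrow> rGamma (1 - d)"
proof (rule Lim_transform_eventually[OF tendsto_pochhammer_Suc_Suc])
  show "eventually (\<lambda>n. pochhammer (1 - d) (n + 2) / (fact n * of_nat n * exp ((1 - d) * of_real (ln (real n))))
      = right_down d n * exp (- (2 - d) * of_real (ln (real n)))) sequentially"
    using eventually_gt_at_top[of 0]
  proof eventually_elim
    case (elim n)
    define L where "L = complex_of_real (ln (real n))"
    have "- (2 - d) * L = - (L + (1 - d) * L)" by (simp add: algebra_simps)
    then have "exp (- (2 - d) * L) = inverse (of_nat n * exp ((1 - d) * L))"
      using exp_ln_of_nat[OF elim] unfolding L_def [symmetric] by (simp only: exp_add exp_minus)
    then show ?case by (simp add: right_down_def L_def divide_inverse mult_ac)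
  qed
qed

lemma tendsto_left_up:
  assumes "a \<notin> \<int>"
  shows "(\<lambda>n. left_up a d n * exp ((d - 2) * of_real (ln (real n)))) \<longlonglongrightarrow> rGamma (1 + a - d) / rGamma a"
proof (rule Lim_transform_eventually[OF tendsto_divide[OF tendsto_pochhammer_Suc_Suc tendsto_pochhammer_Suc]])
  show "rGamma a \<noteq> 0" using assms by (rule rGamma_nonzero)
  show "eventually (\<lambda>n. pochhammer (1 + a - d) (n + 2) / (fact n * of_nat n * exp ((1 + a - d) * of_real (ln (real n))))
      / (pochhammer a (n + 1) / (fact n * exp (a * of_real (ln (real n)))))
      = left_up a d n * exp ((d - 2) * of_real (ln (real n)))) sequentially"
    using eventually_gt_at_top[of 0]
  proof eventually_elim
    case (elim n)
    define L where "L = complex_of_real (ln (real n))"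
    have "(d - 2) * L = a * L - (L + (1 + a - d) * L)" by (simp add: algebra_simps)
    then have "exp ((d - 2) * L) = exp (a * L) / (of_nat n * exp ((1 + a - d) * L))"
      using exp_ln_of_nat[OF elim] unfolding L_def [symmetric] by (simp only: exp_add exp_diff)
    then show ?case by (simp add: left_up_def L_def divide_inverse mult_ac)
  qed
qed

lemma tendsto_left_down:
  assumes nonint: "b - a \<notin> \<int>" "c - a \<notin> \<int>" "e - a \<notin> \<int>" "f - a \<notin> \<int>" "g - a \<notin> \<int>"
    and saal: "e + f + g - a - b - c - d = 1"
  shows "(\<lambda>n. left_down a b c e f g n * exp (- (d - 2) * of_real (ln (real n)))) \<longlonglongrightarrow>
     rGamma (e - a) * rGamma (f - a) * rGamma (g - a) / (rGamma (b - a) * rGamma (c - a))"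
proof (rule Lim_transform_eventually)
  let ?X = "\<lambda>z n. exp (z * of_real (ln (real n))) :: complex"
  let ?T = "\<lambda>z n. pochhammer z (n + 1) / (fact n * ?X z n)"
  let ?U = "\<lambda>z n. pochhammer z n * of_nat n / (fact n * ?X z n)"
  show "(\<lambda>n. ?U (e - a) n * ?U (f - a) n * ?U (g - a) n / (?T (b - a) n * ?T (c - a) n)) \<longlonglongrightarrow>
     rGamma (e - a) * rGamma (f - a) * rGamma (g - a) / (rGamma (b - a) * rGamma (c - a))"
    by (intro tendsto_divide tendsto_mult tendsto_pochhammer tendsto_pochhammer_Suc nonint)
      (simp add: rGamma_nonzero nonint)
  show "eventually (\<lambda>n. ?U (e - a) n * ?U (f - a) n * ?U (g - a) n / (?T (b - a) n * ?T (c - a) n)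
      = left_down a b c e f g n * exp (- (d - 2) * of_real (ln (real n)))) sequentially"
    using eventually_gt_at_top[of 0]
  proof eventually_elim
    case (elim n)
    define L where "L = complex_of_real (ln (real n))"
    have "- (d - 2) = 1 + 1 + 1 + (b - a) + (c - a) - (e - a) - (f - a) - (g - a)" using saal by (simp add: algebra_simps)
    then have "exp (- (d - 2) * L) = exp ((1 + 1 + 1 + (b - a) + (c - a) - (e - a) - (f - a) - (g - a)) * L)"
      by (rule arg_cong)
    \<comment> \<open>The instantiated distributive laws split the outer differences only, so that
      \<open>b - a\<close>, \<open>e - a\<close> and the like survive as exponents.\<close>
    also have "\<dots> = of_nat n * of_nat n * of_nat n * exp ((b - a) * L) * exp ((c - a) * L)
        / exp ((e - a) * L) / exp ((f - a) * L) / exp ((g - a) * L)"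
      using exp_ln_of_nat[OF elim] unfolding L_def [symmetric] left_diff_distrib[of _ "_ - _" L] distrib_right
      by (simp only: exp_add exp_diff[of "_ - _ * L"] exp_diff[of "_ + _" "(_ - _) * L"] mult_1)
    finally have X: "exp (- (d - 2) * L) = \<dots>" .
    have alg: "(pe * N / (q * xe)) * (pf * N / (q * xf)) * (pg * N / (q * xg)) / ((pb / (q * xb)) * (pc / (q * xc)))
       = pe * pf * pg / (pb * pc * q) * (N * N * N * xb * xc / xe / xf / xg)"
      if "q \<noteq> 0" "pb \<noteq> 0" "pc \<noteq> 0" "xe \<noteq> 0" "xf \<noteq> 0" "xg \<noteq> 0" "xb \<noteq> 0" "xc \<noteq> 0"
      for pe pf pg pb pc N q xb xc xe xf xg :: complex
      using that by (simp add: field_simps)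
    show ?case
      unfolding left_down_def X[unfolded L_def]
      by (rule alg) (simp_all add: pochhammer_nonzero nonint)
  qed
qed

lemma F43_term_eq_hyp_coeff:
  assumes "E \<notin> \<int>" "F \<notin> \<int>" "G \<notin> \<int>"
  shows "F43_term A B C D E F G k = hyp_coeff A B C D E F G k * (rGamma E * rGamma F * rGamma G)"
proof -
  have "rGamma (of_nat k + u) = rGamma u / pochhammer u k" if "u \<notin> \<int>" for u :: complex
    using pochhammer_rGamma[of u k] pochhammer_nonzero[OF that, of k] by (simp add: add_ac)
  then show ?thesis using assms by (simp add: F43_term_def hyp_coeff_def)
qed

lemma summable_hyp_coeff:
  assumes "E \<notin> \<int>" "F \<notin> \<int>" "G \<notin> \<int>" and saal: "E + F + G - A - B - C - D = 1"
  shows "summable (\<lambda>k. norm (hyp_coeff A B C D E F G k))"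
    and "(\<Sum>k. hyp_coeff A B C D E F G k) * (rGamma E * rGamma F * rGamma G) = F43_reg A B C D E F G"
proof -
  define r where "r = rGamma E * rGamma F * rGamma G"
  have r: "r \<noteq> 0" unfolding r_def using assms rGamma_nonzero by simp
  have eq: "F43_term A B C D E F G k = hyp_coeff A B C D E F G k * r" for k
    using F43_term_eq_hyp_coeff[OF assms(1-3)] by (simp add: r_def)
  have "hyp_coeff A B C D E F G k = F43_term A B C D E F G k * inverse r" for k
    using r by (simp add: eq)
  then show *: "summable (\<lambda>k. norm (hyp_coeff A B C D E F G k))"
    using summable_mult2[OF summable_F43_term[OF saal], of "norm (inverse r)"] by (simp only: norm_mult)
  show "(\<Sum>k. hyp_coeff A B C D E F G k) * (rGamma E * rGamma F * rGamma G) = F43_reg A B C D E F G"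
    unfolding F43_reg_altdef eq r_def [symmetric]
    by (rule suminf_mult2[OF summable_norm_cancel[OF *]])
qed

lemma notin_Ints_shift: "(1 :: complex) + u - v \<notin> \<int>" if "u - v \<notin> \<int>"
  using that Ints_diff[OF _ Ints_1, of "1 + u - v"] by auto

lemma notin_Ints_diff_commute: "(v :: complex) - u \<notin> \<int>" if "u - v \<notin> \<int>"
  using that by (metis Ints_minus minus_diff_eq)

text \<open>The sines come from the reflection formula: \<open>rGamma (b - a)\<close> and
  \<open>rGamma (c - a)\<close>, which the limit has in the denominator, pair up with
  \<open>rGamma (1 + a - b)\<close> and \<open>rGamma (1 + a - c)\<close> inside the regularised
  series.\<close>

definition left_limit :: "complex \<Rightarrow> complex \<Rightarrow> complex \<Rightarrow> complex \<Rightarrow> complex \<Rightarrow> complex \<Rightarrow> complex \<Rightarrow> complex" where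
  "left_limit a b c d e f g = rGamma (e - a) * rGamma (f - a) * rGamma (g - a)
     / (rGamma a * (sin (of_real pi * (b - a)) / of_real pi) * (sin (of_real pi * (c - a)) / of_real pi))
     * F43_reg a (1 + a - e) (1 + a - f) (1 + a - g) (1 + a - b) (1 + a - c) (1 + a - d)"

lemma left_limit:
  assumes nonint: "a \<notin> \<int>" "b - a \<notin> \<int>" "c - a \<notin> \<int>" "a - d \<notin> \<int>" "e - a \<notin> \<int>" "f - a \<notin> \<int>" "g - a \<notin> \<int>"
    and saal: "e + f + g - a - b - c - d = 1" and d: "Re d = 2"
  shows "(\<lambda>m. \<Sum>k\<le>m. hyp_coeff a (1 + a - e) (1 + a - f) (1 + a - g) (1 + a - b) (1 + a - c) (1 + a - d) k
        * (left_up a d (m + k) * left_down a b c e f g (m - k))) \<longlonglongrightarrow> left_limit a b c d e f g"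
proof -
  note ni = notin_Ints_shift[OF notin_Ints_diff_commute[OF nonint(2)]]
    notin_Ints_shift[OF notin_Ints_diff_commute[OF nonint(3)]] notin_Ints_shift[OF nonint(4)]
  have saal': "1 + a - b + (1 + a - c) + (1 + a - d) - a - (1 + a - e) - (1 + a - f) - (1 + a - g) = 1"
    using saal by (simp add: algebra_simps)
  note h = summable_hyp_coeff[OF ni saal']
  have w: "Re (d - 2) = 0" using d by simp
  have refl': "rGamma (u - a) * rGamma (1 + a - u) = sin (of_real pi * (u - a)) / of_real pi" for u
    using rGamma_reflection_complex[of "u - a"] by (simp add: algebra_simps)
  have "rGamma (1 + a - d) / rGamma a *
     (rGamma (e - a) * rGamma (f - a) * rGamma (g - a) / (rGamma (b - a) * rGamma (c - a))) *
     (\<Sum>k. hyp_coeff a (1 + a - e) (1 + a - f) (1 + a - g) (1 + a - b) (1 + a - c) (1 + a - d) k)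
     = left_limit a b c d e f g"
    unfolding left_limit_def refl' [symmetric] h(2) [symmetric]
    using rGamma_nonzero[OF ni(1)] rGamma_nonzero[OF ni(2)] by simp
  with tendsto_sum_up_down[OF w h(1) tendsto_left_up[OF nonint(1), of d] tendsto_left_down[OF nonint(2,3,5-7) saal]]
  show ?thesis by simp
qed

lemma right_limit:
  assumes nonint: "a \<notin> \<int>" "b \<notin> \<int>" "c \<notin> \<int>" "e \<notin> \<int>" "f \<notin> \<int>" "g \<notin> \<int>"
    and saal: "e + f + g - a - b - c - d = 1" and d: "Re d = 2"
  shows "(\<lambda>m. \<Sum>k\<le>m. hyp_coeff a b c d e f g k * (right_up a b c e f g (m + k) * right_down d (m - k)))
     \<longlonglongrightarrow> rGamma (1 - d) / (rGamma a * rGamma b * rGamma c) * F43_reg a b c d e f g"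
proof -
  note h = summable_hyp_coeff[OF nonint(4-6) saal]
  have w: "Re (2 - d) = 0" using d by simp
  show ?thesis
    using tendsto_sum_up_down[OF w h(1) tendsto_right_up[OF nonint saal] tendsto_right_down]
    by (simp add: h(2) [symmetric] mult_ac)
qed

lemma four_term_relation_generic:
  assumes nonint: "a \<notin> \<int>" "b \<notin> \<int>" "c \<notin> \<int>" "e \<notin> \<int>" "f \<notin> \<int>" "g \<notin> \<int>"
      "a - d \<notin> \<int>" "b - d \<notin> \<int>" "c - d \<notin> \<int>" "a - b \<notin> \<int>" "b - c \<notin> \<int>" "a - c \<notin> \<int>"
      "e - a \<notin> \<int>" "f - a \<notin> \<int>" "g - a \<notin> \<int>" "e - b \<notin> \<int>" "f - b \<notin> \<int>" "g - b \<notin> \<int>"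
      "e - c \<notin> \<int>" "f - c \<notin> \<int>" "g - c \<notin> \<int>"
    and saal: "e + f + g - a - b - c - d = 1" and d: "Re d = 2"
  shows "rGamma (1 - d) / (rGamma a * rGamma b * rGamma c) * F43_reg a b c d e f g =
     left_limit a b c d e f g + left_limit b c a d e f g + left_limit c a b d e f g"
proof (rule LIMSEQ_unique)
  note sw = notin_Ints_diff_commute
  show "(\<lambda>m. \<Sum>k\<le>m. hyp_coeff a b c d e f g k * (right_up a b c e f g (m + k) * right_down d (m - k)))
     \<longlonglongrightarrow> rGamma (1 - d) / (rGamma a * rGamma b * rGamma c) * F43_reg a b c d e f g"
    by (rule right_limit[OF nonint(1-6) saal d])
  have saal': "e + f + g - b - c - a - d = 1" "e + f + g - c - a - b - d = 1"
    using saal by (simp_all add: algebra_simps)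
  show "(\<lambda>m. \<Sum>k\<le>m. hyp_coeff a b c d e f g k * (right_up a b c e f g (m + k) * right_down d (m - k)))
     \<longlonglongrightarrow> left_limit a b c d e f g + left_limit b c a d e f g + left_limit c a b d e f g"
    unfolding trunc_relation[OF nonint(1-12)]
    by (intro tendsto_add left_limit saal saal' d nonint sw[OF nonint(10)] sw[OF nonint(11)] sw[OF nonint(12)])
qed

text \<open>With \<open>p z = exp (2 * \<i> * z)\<close> every sine of a difference becomes a
  difference of values of \<open>p\<close> over a monomial. Over the common denominator
  \<open>M\<close> the claim is a polynomial identity in the six values of \<open>p\<close>.\<close>

lemma sin_cyclic_identity:
  fixes a b c d e f g :: complex
  assumes "e + f + g = a + b + c + d"
  shows "sin (c - b) * sin (e - a) * sin (f - a) * sin (g - a)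
       + sin (a - c) * sin (e - b) * sin (f - b) * sin (g - b)
       + sin (b - a) * sin (e - c) * sin (f - c) * sin (g - c)
     = sin d * sin (b - a) * sin (c - a) * sin (c - b)"
proof -
  define X where "X z = exp (\<i> * z)" for z
  define p where "p z = X z * X z" for z
  have X: "X z \<noteq> 0" for z by (simp add: X_def)
  have s: "sin (u - v) = (p u - p v) / (2 * \<i> * X u * X v)" for u v
  proof -
    have "sin (u - v) = (X u / X v - X v / X u) / (2 * \<i>)"
      by (simp add: sin_exp_eq X_def exp_diff[symmetric] algebra_simps)
    then show ?thesis using X[of u] X[of v] by (simp add: p_def field_simps)
  qed
  have "d = e + f + g - (a + b + c)" using assms by (simp add: algebra_simps)
  then have d: "sin d = (p e * p f * p g - p a * p b * p c) / (2 * \<i> * (X e * X f * X g) * (X a * X b * X c))"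
    using s[of "e + f + g" "a + b + c"] by (simp add: p_def X_def distrib_left exp_add mult_ac)
  define M where "M = (2 * \<i>) ^ 4 * (X e * X f * X g) * (X a * X b * X c) ^ 3"
  \<comment> \<open>The product of these four sines has each of \<open>X v\<close>,
    \<open>X w\<close> once and \<open>X u\<close> three times in its denominator. Extending to the
    cubes in \<open>M\<close> costs \<open>(X v * X w)^2\<close>, which is
    \<open>p v * p w\<close>.\<close>
  have t: "sin (w - v) * sin (e - u) * sin (f - u) * sin (g - u)
      = (p w - p v) * p v * p w * (p e - p u) * (p f - p u) * (p g - p u) / M"
    if "M = (2 * \<i>) ^ 4 * (X e * X f * X g) * (X u * X v * X w) ^ 3" for u v w
    unfolding s that using X[of u] X[of v] X[of w] X[of e] X[of f] X[of g]
    by (simp add: p_def divide_simps) (simp add: eval_nat_numeral mult_ac)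
  have r: "sin d * sin (b - a) * sin (c - a) * sin (c - b)
     = (p e * p f * p g - p a * p b * p c) * (p b - p a) * (p c - p a) * (p c - p b) / M"
    unfolding s d M_def using X[of a] X[of b] X[of c] X[of e] X[of f] X[of g]
    by (simp add: divide_simps) (simp add: eval_nat_numeral mult_ac)
  have alg: "(r - q) * q * r * (x - s) * (y - s) * (z - s) + (s - r) * r * s * (x - q) * (y - q) * (z - q)
     + (q - s) * s * q * (x - r) * (y - r) * (z - r) = (x * y * z - s * q * r) * (q - s) * (r - s) * (r - q)"
    for q r s x y z :: complex by algebra
  have "M = (2 * \<i>) ^ 4 * (X e * X f * X g) * (X b * X c * X a) ^ 3"
     "M = (2 * \<i>) ^ 4 * (X e * X f * X g) * (X c * X a * X b) ^ 3"
    by (simp_all add: M_def mult_ac)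
  from t[OF this(1)] t[OF this(2)] show ?thesis
    unfolding t[OF M_def] r by (simp only: add_divide_distrib [symmetric] alg)
qed

section \<open>The relation for \<open>K\<close>\<close>

lemma F43_reg_rotate_upper: "F43_reg B C D A E F G = F43_reg A B C D E F G"
  by (simp add: F43_reg_def mult_ac)

lemma F43_reg_swap_lower:
  "F43_reg A B C D E G F = F43_reg A B C D E F G" "F43_reg A B C D F E G = F43_reg A B C D E F G"
  by (simp_all add: F43_reg_def mult_ac)

lemma K_vector:
  "K (vector [a, b, c, d, e, f, g]) =
     F43_reg a b c d e f g * rGamma (1 + a - e) * rGamma (1 + a - f) * rGamma (1 + a - g)
   + F43_reg a (1 + a - e) (1 + a - f) (1 + a - g) (1 + a - b) (1 + a - c) (1 + a - d)
       * rGamma b * rGamma c * rGamma d"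
  by (simp add: K_def)

lemma \<alpha>_vector:
  "\<alpha> (vector [a, b, c, d, e, f, g]) =
     sin (of_real pi * (c - b)) * rGamma (e - a) * rGamma (f - a) * rGamma (g - a)"
  by (simp add: \<alpha>_def)

text \<open>The left-hand side as a function of seven scalars, so that it can be restricted to a
  complex line in \<open>V\<close>.\<close>

definition K_relation_lhs :: "complex \<Rightarrow> complex \<Rightarrow> complex \<Rightarrow> complex \<Rightarrow> complex \<Rightarrow> complex \<Rightarrow> complex \<Rightarrow> complex" where
  "K_relation_lhs a b c d e f g =
     \<alpha> (vector [a, b, c, d, e, f, g]) * K (vector [a, b, c, d, e, f, g])
   + \<alpha> (vector [b, c, a, d, e, f, g]) * K (vector [b, c, d, a, e, f, g])
   + \<alpha> (vector [c, a, b, d, e, f, g]) * K (vector [c, d, a, b, e, f, g])"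

lemma sin_pi_nonzero:
  assumes "(z :: complex) \<notin> \<int>"
  shows "sin (of_real pi * z) \<noteq> 0"
proof -
  have "1 - z \<notin> \<int>" using assms Ints_diff[OF Ints_1, of "1 - z"] by auto
  then show ?thesis
    using rGamma_reflection_complex[of z] rGamma_nonzero[OF assms] rGamma_nonzero[of "1 - z"] by auto
qed

text \<open>The first series is symmetric in \<open>a, b, c, d\<close>, so all three
  \<open>K\<close>-values share it. By reflection its total coefficient is a sum of sine products,
  evaluated by \<open>sin_cyclic_identity\<close>; the second series add up, by the four-term
  relation, to the negative of that contribution.\<close>

lemma K_relation_generic:
  assumes nonint: "a \<notin> \<int>" "b \<notin> \<int>" "c \<notin> \<int>" "e \<notin> \<int>" "f \<notin> \<int>" "g \<notin> \<int>"
      "a - d \<notin> \<int>" "b - d \<notin> \<int>" "c - d \<notin> \<int>" "a - b \<notin> \<int>" "b - c \<notin> \<int>" "a - c \<notin> \<int>"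
      "e - a \<notin> \<int>" "f - a \<notin> \<int>" "g - a \<notin> \<int>" "e - b \<notin> \<int>" "f - b \<notin> \<int>" "g - b \<notin> \<int>"
      "e - c \<notin> \<int>" "f - c \<notin> \<int>" "g - c \<notin> \<int>"
    and saal: "e + f + g - a - b - c - d = 1" and d: "Re d = 2"
  shows "K_relation_lhs a b c d e f g = 0"
proof -
  define s where "s z = sin (of_real pi * z :: complex)" for z
  define p where "p = complex_of_real pi"
  have p: "p \<noteq> 0" by (simp add: p_def)
  have refl': "rGamma (u - v) * rGamma (1 + v - u) = s (u - v) / p" for u v
  proof -
    have "1 - (u - v) = 1 + v - u" by simp
    with rGamma_reflection_complex[of "u - v"] show ?thesis by (simp only: s_def p_def)
  qed
  have refl_d: "rGamma d * rGamma (1 - d) = s d / p"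
    using rGamma_reflection_complex[of d] by (simp only: s_def p_def)
  have s_minus: "s (u - v) = - s (v - u)" for u v
  proof -
    have "complex_of_real pi * (u - v) = - (complex_of_real pi * (v - u))" by (simp add: algebra_simps)
    then show ?thesis unfolding s_def by (simp only: sin_minus)
  qed
  define F where "F = F43_reg a b c d e f g"
  define Ga where "Ga = F43_reg a (1 + a - e) (1 + a - f) (1 + a - g) (1 + a - b) (1 + a - c) (1 + a - d)"
  define Gb where "Gb = F43_reg b (1 + b - e) (1 + b - f) (1 + b - g) (1 + b - c) (1 + b - d) (1 + b - a)"
  define Gc where "Gc = F43_reg c (1 + c - e) (1 + c - f) (1 + c - g) (1 + c - d) (1 + c - a) (1 + c - b)"
  define ra rb rc rd where "ra = rGamma a" and "rb = rGamma b" and "rc = rGamma c" and "rd = rGamma d"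
  have r: "ra \<noteq> 0" "rb \<noteq> 0" "rc \<noteq> 0"
    unfolding ra_def rb_def rc_def by (intro rGamma_nonzero nonint)+
  have s: "s (b - a) \<noteq> 0" "s (c - b) \<noteq> 0" "s (c - a) \<noteq> 0"
    unfolding s_def by (intro sin_pi_nonzero nonint(10-12)[THEN notin_Ints_diff_commute])+
  define T where "T u = rGamma (e - u) * rGamma (f - u) * rGamma (g - u)" for u
  have F: "F43_reg b c d a e f g = F" "F43_reg c d a b e f g = F"
    unfolding F_def by (rule F43_reg_rotate_upper, rule trans[OF F43_reg_rotate_upper F43_reg_rotate_upper])
  have "rGamma (1 - d) / (ra * rb * rc) * F = left_limit a b c d e f g + left_limit b c a d e f g + left_limit c a b d e f g"
    unfolding ra_def rb_def rc_def F_def by (rule four_term_relation_generic[OF nonint saal d])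
  also have "left_limit a b c d e f g = T a / (ra * (s (b - a) / p) * (s (c - a) / p)) * Ga"
    by (simp add: left_limit_def T_def ra_def s_def p_def Ga_def)
  also have "left_limit b c a d e f g = T b / (rb * (s (c - b) / p) * (s (a - b) / p)) * Gb"
    by (simp add: left_limit_def T_def rb_def s_def p_def Gb_def F43_reg_swap_lower)
  also have "left_limit c a b d e f g = T c / (rc * (s (a - c) / p) * (s (b - c) / p)) * Gc"
    by (simp add: left_limit_def T_def rc_def s_def p_def Gc_def F43_reg_swap_lower)
  finally have four: "rGamma (1 - d) / (ra * rb * rc) * F =
     T a / (ra * (s (b - a) / p) * (s (c - a) / p)) * Ga
     + T b / (rb * (s (c - b) / p) * (s (a - b) / p)) * Gb
     + T c / (rc * (s (a - c) / p) * (s (b - c) / p)) * Gc" .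
  have alg: "y1 * y2 * y3 / p\<^sup>2 * (r1 * r2 * r3 * r4) * (T' / (r1 * (y1 / p) * (y2 / p)) * G) = y3 * T' * G * (r2 * r3 * r4)"
    if "y1 \<noteq> 0" "y2 \<noteq> 0" "r1 \<noteq> 0" for y1 y2 y3 r1 r2 r3 r4 T' G
    using that p by (simp add: field_simps power2_eq_square)
  \<comment> \<open>The multiplier that clears the sines and the reciprocal \<open>rGamma\<close>
    values in the four-term relation. It leaves the second series with the coefficients they have in
    \<alpha> times \<open>K\<close>, and it supplies the \<open>rd\<close> that combines with
    \<open>rGamma (1 - d)\<close> to \<open>s d / p\<close>.\<close>
  define m where "m = s (b - a) * s (c - a) * s (c - b) / p\<^sup>2 * (ra * rb * rc * rd)"
  have alg': "y1 * y2 * y3 / p\<^sup>2 * (r1 * r2 * r3 * r4) * (r4' / (r1 * r2 * r3) * G) = y1 * y2 * y3 / p\<^sup>2 * (r4 * r4') * G"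
    if "r1 \<noteq> 0" "r2 \<noteq> 0" "r3 \<noteq> 0" for y1 y2 y3 r1 r2 r3 r4 r4' G
    using that by simp
  have "m * (rGamma (1 - d) / (ra * rb * rc) * F) = s (b - a) * s (c - a) * s (c - b) / p\<^sup>2 * (rd * rGamma (1 - d)) * F"
    unfolding m_def by (rule alg') (rule r)+
  also have "\<dots> = s d * s (b - a) * s (c - a) * s (c - b) / p ^ 3 * F"
    unfolding rd_def refl_d by (simp add: power2_eq_square power3_eq_cube)
  also have "m * (rGamma (1 - d) / (ra * rb * rc) * F) = s (c - b) * T a * Ga * (rb * rc * rd)
     + s (a - c) * T b * Gb * (rc * rd * ra) + s (b - a) * T c * Gc * (rd * ra * rb)"
  proof -
    \<comment> \<open>In each rotated form two sines change sign, so the product is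
      unchanged.\<close>
    have m': "m = s (c - b) * s (a - b) * s (a - c) / p\<^sup>2 * (rb * rc * rd * ra)"
      "m = s (a - c) * s (b - c) * s (b - a) / p\<^sup>2 * (rc * rd * ra * rb)"
      unfolding m_def s_minus[of a b] s_minus[of a c] s_minus[of b c] by (simp_all add: mult_ac)
    have s': "s (a - b) \<noteq> 0" "s (b - c) \<noteq> 0" "s (a - c) \<noteq> 0"
      using s unfolding s_minus[of a b] s_minus[of a c] s_minus[of b c] by simp_all
    have 1: "m * (T a / (ra * (s (b - a) / p) * (s (c - a) / p)) * Ga) = s (c - b) * T a * Ga * (rb * rc * rd)"
      unfolding m_def by (rule alg) (rule s r)+
    have 2: "m * (T b / (rb * (s (c - b) / p) * (s (a - b) / p)) * Gb) = s (a - c) * T b * Gb * (rc * rd * ra)"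
      unfolding m'(1) by (rule alg) (rule s s' r)+
    have 3: "m * (T c / (rc * (s (a - c) / p) * (s (b - c) / p)) * Gc) = s (b - a) * T c * Gc * (rd * ra * rb)"
      unfolding m'(2) by (rule alg) (rule s s' r)+
    show ?thesis unfolding four distrib_left 1 2 3 ..
  qed
  finally have second: "s (c - b) * T a * Ga * (rb * rc * rd) + s (a - c) * T b * Gb * (rc * rd * ra)
     + s (b - a) * T c * Gc * (rd * ra * rb) = s d * s (b - a) * s (c - a) * s (c - b) / p ^ 3 * F" .
  have T: "T u * (rGamma (1 + u - e) * rGamma (1 + u - f) * rGamma (1 + u - g)) = s (e - u) * s (f - u) * s (g - u) / p ^ 3" for u
  proof -
    have "T u * (rGamma (1 + u - e) * rGamma (1 + u - f) * rGamma (1 + u - g)) =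
       (rGamma (e - u) * rGamma (1 + u - e)) * (rGamma (f - u) * rGamma (1 + u - f)) * (rGamma (g - u) * rGamma (1 + u - g))"
      by (simp add: T_def mult_ac)
    then show ?thesis unfolding refl' by (simp add: power3_eq_cube)
  qed
  \<comment> \<open>The sine identity requires equal sums, but here they differ by 1. It is
    therefore applied with \<open>p * d + p\<close> in place of its \<open>d\<close>, which accounts
    for the minus sign in front of \<open>s d\<close>.\<close>
  have "p * e + p * f + p * g = p * a + p * b + p * c + (p * d + p)"
  proof -
    have *: "e + f + g = a + b + c + d + 1" using saal by (simp add: algebra_simps)
    have "p * (e + f + g) = p * (a + b + c + d + 1)" unfolding * ..
    then show ?thesis by (simp add: distrib_left)
  qed
  note cyc = sin_cyclic_identity[OF this]
  have "sin (p * d + p) = - s d" by (simp add: s_def p_def sin_add sin_of_real cos_of_real)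
  with cyc have cyc: "s (c - b) * s (e - a) * s (f - a) * s (g - a) + s (a - c) * s (e - b) * s (f - b) * s (g - b)
     + s (b - a) * s (e - c) * s (f - c) * s (g - c) = - s d * s (b - a) * s (c - a) * s (c - b)"
    by (simp only: s_def p_def right_diff_distrib)
  have alg: "s0 * t1 * t2 * t3 * (F * x1 * x2 * x3 + G * r1 * r2 * r3) = s0 * (t1 * t2 * t3 * (x1 * x2 * x3)) * F + s0 * (t1 * t2 * t3) * G * (r1 * r2 * r3)"
    for s0 t1 t2 t3 x1 x2 x3 r1 r2 r3 F G :: complex
    by (simp add: distrib_left mult_ac)
  have "K_relation_lhs a b c d e f g =
     (s (c - b) * (T a * (rGamma (1 + a - e) * rGamma (1 + a - f) * rGamma (1 + a - g)))
    + s (a - c) * (T b * (rGamma (1 + b - e) * rGamma (1 + b - f) * rGamma (1 + b - g)))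
    + s (b - a) * (T c * (rGamma (1 + c - e) * rGamma (1 + c - f) * rGamma (1 + c - g)))) * F
    + (s (c - b) * T a * Ga * (rb * rc * rd) + s (a - c) * T b * Gb * (rc * rd * ra)
       + s (b - a) * T c * Gc * (rd * ra * rb))"
    unfolding K_relation_lhs_def K_vector \<alpha>_vector F F_def [symmetric] Ga_def [symmetric] Gb_def [symmetric]
      Gc_def [symmetric] ra_def [symmetric] rb_def [symmetric] rc_def [symmetric] rd_def [symmetric] alg
      T_def [symmetric] s_def [symmetric] distrib_right by (simp only: add_ac)
  also have "\<dots> = (s (c - b) * s (e - a) * s (f - a) * s (g - a) + s (a - c) * s (e - b) * s (f - b) * s (g - b)
     + s (b - a) * s (e - c) * s (f - c) * s (g - c)) / p ^ 3 * F + s d * s (b - a) * s (c - a) * s (c - b) / p ^ 3 * F"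
    unfolding T second by (simp only: add_divide_distrib times_divide_eq_right mult.assoc)
  also have "\<dots> = 0" unfolding cyc by simp
  finally show ?thesis .
qed

section \<open>Analytic continuation along a complex line\<close>

lemma holomorphic_K_vector:
  assumes hol: "a holomorphic_on UNIV" "b holomorphic_on UNIV" "c holomorphic_on UNIV" "d holomorphic_on UNIV"
      "e holomorphic_on UNIV" "f holomorphic_on UNIV" "g holomorphic_on UNIV"
    and saal: "\<And>z. e z + f z + g z - a z - b z - c z - d z = 1"
  shows "(\<lambda>z. K (vector [a z, b z, c z, d z, e z, f z, g z])) holomorphic_on UNIV"
proof -
  have "1 + a z - b z + (1 + a z - c z) + (1 + a z - d z) - a z - (1 + a z - e z) - (1 + a z - f z) - (1 + a z - g z) = 1" for z
    using saal[of z] by (simp add: algebra_simps)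
  then show ?thesis
    unfolding K_vector
    by (intro holomorphic_intros holomorphic_F43_reg hol saal) auto
qed

lemma notin_Ints_if_Im_nonzero: "Im z \<noteq> 0 \<Longrightarrow> z \<notin> \<int>"
  by (auto simp: complex_is_Int_iff)

text \<open>The direction \<open>(2, 4, 8, 1, 3, 5, 7)\<close> is tangent to \<open>V\<close>, and all differences that must avoid the
  integers have nonzero slope along it.\<close>

lemma K_relation:
  assumes saal: "e + f + g - a - b - c - d = 1"
  shows "K_relation_lhs a b c d e f g = 0"
proof -
  define h where "h z = K_relation_lhs (a + 2 * z) (b + 4 * z) (c + 8 * z) (d + z) (e + 3 * z) (f + 5 * z) (g + 7 * z)" for z
  have saal': "e + 3 * z + (f + 5 * z) + (g + 7 * z) - (a + 2 * z) - (b + 4 * z) - (c + 8 * z) - (d + z) = 1"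
    "e + 3 * z + (f + 5 * z) + (g + 7 * z) - (b + 4 * z) - (c + 8 * z) - (d + z) - (a + 2 * z) = 1"
    "e + 3 * z + (f + 5 * z) + (g + 7 * z) - (c + 8 * z) - (d + z) - (a + 2 * z) - (b + 4 * z) = 1" for z
    using saal by (simp_all add: algebra_simps)
  have hol: "h holomorphic_on UNIV"
    unfolding h_def K_relation_lhs_def \<alpha>_vector
    by (intro holomorphic_intros holomorphic_K_vector saal')
  define M where "M = \<bar>Im a\<bar> + \<bar>Im b\<bar> + \<bar>Im c\<bar> + \<bar>Im d\<bar> + \<bar>Im e\<bar> + \<bar>Im f\<bar> + \<bar>Im g\<bar>"
  have M: "\<bar>Im a\<bar> \<le> M" "\<bar>Im b\<bar> \<le> M" "\<bar>Im c\<bar> \<le> M" "\<bar>Im d\<bar> \<le> M" "\<bar>Im e\<bar> \<le> M" "\<bar>Im f\<bar> \<le> M" "\<bar>Im g\<bar> \<le> M"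
    by (simp_all add: M_def)
  \<comment> \<open>The slope of \<open>d\<close> is 1, so fixing \<open>Re z\<close> places the
    fourth parameter on the line with real part 2. The quantities that must avoid the integers have
    imaginary part at most \<open>2 * M\<close> in modulus at \<open>z = 0\<close> and slope at
    least 1 in modulus, so \<open>Im z > 2 * M\<close> keeps them non-real. This vertical ray has
    limit points, which is all that the identity theorem needs.\<close>
  define U where "U = {z. Re z = 2 - Re d \<and> Im z > 2 * M}"
  have zero: "h z = 0" if "z \<in> U" for z
  proof -
    have z: "Re z = 2 - Re d" "Im z > 2 * M" using that by (auto simp: U_def)
    show ?thesis
      unfolding h_def
    proof (rule K_relation_generic)
      show "e + 3 * z + (f + 5 * z) + (g + 7 * z) - (a + 2 * z) - (b + 4 * z) - (c + 8 * z) - (d + z) = 1"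
        by (rule saal')
    qed ((rule notin_Ints_if_Im_nonzero)?, use z M in \<open>simp add: abs_le_iff\<close>)+
  qed
  define \<xi> where "\<xi> = Complex (2 - Re d) (2 * M + 1)"
  have "\<xi> islimpt U"
    unfolding islimpt_approachable
  proof (intro allI impI)
    fix r :: real assume r: "0 < r"
    have "M \<ge> 0" by (simp add: M_def)
    show "\<exists>x\<in>U. x \<noteq> \<xi> \<and> dist x \<xi> < r"
      by (rule bexI[of _ "\<xi> + \<i> * of_real (r / 2)"]) (use r in \<open>auto simp: U_def \<xi>_def dist_norm norm_mult\<close>)
  qed
  then have "h 0 = 0"
    by (rule analytic_continuation[OF hol open_UNIV connected_UNIV subset_UNIV UNIV_I]) (use zero in auto)
  then show ?thesis by (simp add: h_def)
qed

section \<open>The action of \<open>M_K\<close> by signed permutation matrices\<close>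

lemma UNIV_6: "(UNIV :: 6 set) = {1, 2, 3, 4, 5, 6}"
proof (rule sym, rule card_subset_eq)
  show "card {1, 2, 3, 4, 5, 6 :: 6} = card (UNIV :: 6 set)" by simp
qed auto

lemma forall_6: "(\<forall>i::6. P i) \<longleftrightarrow> P 1 \<and> P 2 \<and> P 3 \<and> P 4 \<and> P 5 \<and> P 6"
  by (metis UNIV_6 UNIV_I empty_iff insert_iff)

lemma sum_6: "sum f (UNIV :: 6 set) = f 1 + f 2 + f 3 + f 4 + f 5 + f 6"
  unfolding UNIV_6 by (simp add: add.assoc)

lemma sum_7: "sum f (UNIV :: 7 set) = f 1 + f 2 + f 3 + f 4 + f 5 + f 6 + f 7"
  unfolding UNIV_7 by (simp add: add.assoc)

lemma vector_6 [simp]: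
  "(vector [a,b,c,d,e,f] :: 'a::zero^6) $ 1 = a"
  "(vector [a,b,c,d,e,f] :: 'a::zero^6) $ 2 = b"
  "(vector [a,b,c,d,e,f] :: 'a::zero^6) $ 3 = c"
  "(vector [a,b,c,d,e,f] :: 'a::zero^6) $ 4 = d"
  "(vector [a,b,c,d,e,f] :: 'a::zero^6) $ 5 = e"
  "(vector [a,b,c,d,e,f] :: 'a::zero^6) $ 6 = f"
  unfolding vector_def by simp_all

section \<open>Permutation matrices and the group \<open>GL\<close>\<close>

lemma perm_matrix_vector: "perm_matrix \<sigma> *v x = (\<chi> i. x $ \<sigma> i)"
  by (simp add: perm_matrix_def matrix_vector_mult_def vec_eq_iff if_distrib if_distribR cong: if_cong)

lemma perm_matrix_comp: "perm_matrix (\<sigma> \<circ> \<tau>) = perm_matrix \<tau> ** perm_matrix \<sigma>"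
  by (simp add: matrix_eq matrix_vector_mul_assoc [symmetric] perm_matrix_vector)

lemma perm_matrix_id: "perm_matrix id = mat 1"
  by (simp add: matrix_eq perm_matrix_vector)

lemma invertible_perm_matrix:
  assumes "bij \<sigma>"
  shows "invertible (perm_matrix \<sigma>)"
  unfolding invertible_def
proof (intro exI conjI)
  show "perm_matrix \<sigma> ** perm_matrix (inv_into UNIV \<sigma>) = mat 1"
    using assms by (simp add: perm_matrix_comp [symmetric] perm_matrix_id bij_is_inj)
  show "perm_matrix (inv_into UNIV \<sigma>) ** perm_matrix \<sigma> = mat 1"
    using assms surj_iff[of \<sigma>] by (simp add: perm_matrix_comp [symmetric] perm_matrix_id bij_is_surj)
qed

lemma invertible_mat_1: "invertible (mat 1 :: real^'n^'n)"
  unfolding invertible_def by (intro exI[of _ "mat 1"]) simp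

lemma matrix_inv_mult:
  assumes "invertible (A :: real^'n^'n)"
  shows "A ** matrix_inv A = mat 1" "matrix_inv A ** A = mat 1"
  using someI_ex[OF assms[unfolded invertible_def]] by (simp_all add: matrix_inv_def)

lemma matrix_inv_unique':
  assumes "A ** B = mat 1" "B ** A = mat 1"
  shows "matrix_inv (A :: real^'n^'n) = B"
proof -
  have "invertible A" using assms by (auto simp: invertible_def)
  then have "matrix_inv A = matrix_inv A ** (A ** B)" using assms by simp
  also have "\<dots> = B" using matrix_inv_mult[OF \<open>invertible A\<close>] by (simp add: matrix_mul_assoc)
  finally show ?thesis .
qed

lemma group_GL: "group (GL :: (real^'n^'n) monoid)"
proof (rule groupI)
  fix A :: "real^'n^'n" assume "A \<in> carrier GL"
  then have "invertible A" by (simp add: GL_def)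
  note inv = matrix_inv_mult[OF this]
  then have "invertible (matrix_inv A)" unfolding invertible_def by blast
  with inv show "\<exists>B\<in>carrier GL. B \<otimes>\<^bsub>GL\<^esub> A = \<one>\<^bsub>GL\<^esub>"
    by (intro bexI[of _ "matrix_inv A"]) (simp_all add: GL_def)
next
  show "\<one>\<^bsub>GL\<^esub> \<in> carrier (GL :: (real^'n^'n) monoid)" by (simp add: GL_def invertible_mat_1)
qed (simp_all add: GL_def invertible_mult matrix_mul_assoc)

lemma GL_simps [simp]:
  "carrier GL = {A. invertible A}" "x \<otimes>\<^bsub>GL\<^esub> y = x ** y" "\<one>\<^bsub>GL\<^esub> = mat 1"
  by (simp_all add: GL_def)

lemma S_vector: "S *v y = vector [y $ 1, y $ 3 + y $ 4, y $ 2 + y $ 4, y $ 2 + y $ 3,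
   y $ 2 + y $ 3 + y $ 4 + y $ 5, y $ 2 + y $ 3 + y $ 4 + y $ 6, y $ 2 + y $ 3 + y $ 4 + y $ 7]"
  unfolding vec_eq_iff forall_7 matrix_vector_mult_def vec_lambda_beta sum_7 S_def vector_7 by simp

text \<open>The inverse of \<open>S\<close>, followed by \<open>y \<mapsto> (y\<^sub>2 - y\<^sub>1/2, ..., y\<^sub>7 - y\<^sub>1/2)\<close>; it intertwines \<open>M_K\<close>
  with the group of signed permutation matrices.\<close>

definition intertwiner :: "real^7 \<Rightarrow> real^6" where
  "intertwiner x = vector [(x$3 + x$4 - x$1 - x$2) / 2, (x$2 + x$4 - x$1 - x$3) / 2, (x$2 + x$3 - x$1 - x$4) / 2,
     x$5 - (x$1 + x$2 + x$3 + x$4) / 2, x$6 - (x$1 + x$2 + x$3 + x$4) / 2, x$7 - (x$1 + x$2 + x$3 + x$4) / 2]"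

text \<open>The form that equals 1 on \<open>V\<close>. The kernel of \<open>intertwiner\<close> is
  spanned by \<open>S\<close> applied to \<open>(1, 1/2, ..., 1/2)\<close>, where this form takes
  the value 2; so it supplies the coordinate that \<open>intertwiner\<close> loses.\<close>

definition saal_form :: "real^7 \<Rightarrow> real" where
  "saal_form x = x$5 + x$6 + x$7 - x$1 - x$2 - x$3 - x$4"

definition idx_shift :: "6 \<Rightarrow> 7" where
  "idx_shift i = (if i = 1 then 2 else if i = 2 then 3 else if i = 3 then 4 else if i = 4 then 5 else if i = 5 then 6 else 7)"

lemma idx_shift_simps [simp]:
  "idx_shift 1 = 2" "idx_shift 2 = 3" "idx_shift 3 = 4" "idx_shift 4 = 5" "idx_shift 5 = 6" "idx_shift 6 = 7"
  by (simp_all add: idx_shift_def)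

lemma bij_idx_shift: "bij_betw idx_shift UNIV (UNIV - {1})"
  unfolding bij_betw_def
proof
  show "inj idx_shift" unfolding inj_def forall_6 by simp
  show "range idx_shift = UNIV - {1}" unfolding UNIV_6 UNIV_7 by auto
qed

lemma intertwiner_surj: "\<exists>x. intertwiner x = v"
proof
  \<comment> \<open>The witness is \<open>S\<close> applied to \<open>(0, v)\<close>.\<close>
  show "intertwiner (vector [0, v$2 + v$3, v$1 + v$3, v$1 + v$2, v$1 + v$2 + v$3 + v$4,
      v$1 + v$2 + v$3 + v$5, v$1 + v$2 + v$3 + v$6]) = v"
    unfolding intertwiner_def vec_eq_iff forall_6 vector_6 vector_7 by (intro conjI; simp add: field_simps)
qed

text \<open>The last three coordinates of \<open>intertwiner\<close> add up to
  \<open>saal_form\<close> minus half of \<open>x$1 + x$2 + x$3 + x$4\<close>. This determines that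
  sum, and then each coordinate separately.\<close>

lemma intertwiner_inj:
  assumes "intertwiner x = intertwiner y" "saal_form x = saal_form y"
  shows "x = y"
proof -
  have e: "intertwiner x $ i = intertwiner y $ i" for i using assms by simp
  note e' = e[of 1] e[of 2] e[of 3] e[of 4] e[of 5] e[of 6] assms(2)
  note e' = e'[unfolded intertwiner_def saal_form_def vector_6]
  have "x$1 + x$2 + x$3 + x$4 = y$1 + y$2 + y$3 + y$4" using e'(4-7) by argo
  with e' have "x $ 1 = y $ 1" "x $ 2 = y $ 2" "x $ 3 = y $ 3" "x $ 4 = y $ 4" "x $ 5 = y $ 5" "x $ 6 = y $ 6" "x $ 7 = y $ 7"
    by argo+
  then show ?thesis unfolding vec_eq_iff forall_7 by blast
qed

lemma intertwiner_S: "intertwiner (S *v y) = (\<chi> i. y $ idx_shift i - y $ 1 / 2)"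
  unfolding intertwiner_def S_vector vec_eq_iff forall_6 vector_6 vector_7 vec_lambda_beta idx_shift_simps
  by (intro conjI; simp add: field_simps)

lemma saal_form_S: "saal_form (S *v y) = y$2 + y$3 + y$4 + y$5 + y$6 + y$7 - y$1"
  by (simp add: saal_form_def S_vector)

lemma S_mult_vector_eq_0: "S *v y = 0 \<Longrightarrow> y = 0"
  unfolding S_vector vec_eq_iff forall_7 vector_7 zero_index by (elim conjE, intro conjI; linarith)

lemma invertible_S: "invertible S"
  using S_mult_vector_eq_0
  by (simp add: invertible_left_inverse matrix_left_invertible_ker)

definition intertwines :: "real^7^7 \<Rightarrow> real^6^6 \<Rightarrow> bool" where
  "intertwines \<mu> N \<longleftrightarrow> (\<forall>x. intertwiner (\<mu> *v x) = N *v intertwiner x)"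

lemma intertwines_unique:
  assumes "intertwines \<mu> N" "intertwines \<mu> N'"
  shows "N = N'"
  unfolding matrix_eq
proof
  fix v
  obtain x where "v = intertwiner x" using intertwiner_surj by metis
  then show "N *v v = N' *v v" using assms by (simp add: intertwines_def)
qed

lemma intertwines_mult:
  assumes "intertwines \<mu> N" "intertwines \<nu> N'"
  shows "intertwines (\<mu> ** \<nu>) (N ** N')"
  using assms by (simp add: intertwines_def matrix_vector_mul_assoc [symmetric])

lemma intertwines_one: "intertwines (mat 1) (mat 1)"
  by (simp add: intertwines_def)

text \<open>The invariant for the induction over \<open>generate\<close>: it holds for the
  generators and is stable under products and inverses. It records what the construction of \<theta>
  and its injectivity require.\<close>

definition admissible :: "real^7^7 \<Rightarrow> bool" where
  "admissible \<mu> \<longleftrightarrow> invertible \<mu> \<and> (\<forall>x. saal_form (\<mu> *v x) = saal_form x) \<and> (\<exists>N. invertible N \<and> intertwines \<mu> N)"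

lemma admissible_one: "admissible (mat 1)"
  by (auto simp: admissible_def invertible_mat_1 intertwines_one intro!: exI[of _ "mat 1"])

lemma admissible_mult:
  assumes "admissible \<mu>" "admissible \<nu>"
  shows "admissible (\<mu> ** \<nu>)"
  using assms intertwines_mult invertible_mult unfolding admissible_def
  by (metis matrix_vector_mul_assoc)

lemma admissible_inverse:
  assumes "admissible \<mu>" and inv: "\<mu> ** \<nu> = mat 1" "\<nu> ** \<mu> = mat 1"
  shows "admissible \<nu>"
proof -
  have c: "\<mu> *v (\<nu> *v x) = x" for x
    using inv by (simp add: matrix_vector_mul_assoc)
  obtain N where N: "invertible N" "intertwines \<mu> N" using assms by (auto simp: admissible_def)
  note NN = matrix_inv_mult[OF N(1)]
  have "saal_form (\<nu> *v x) = saal_form x" for x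
    using assms(1) c[of x] unfolding admissible_def by metis
  moreover have "intertwines \<nu> (matrix_inv N)"
    unfolding intertwines_def
  proof
    fix x
    have "N *v intertwiner (\<nu> *v x) = intertwiner x"
      using N(2) c[of x] unfolding intertwines_def by metis
    then have "matrix_inv N *v (N *v intertwiner (\<nu> *v x)) = matrix_inv N *v intertwiner x" by simp
    then show "intertwiner (\<nu> *v x) = matrix_inv N *v intertwiner x"
      using NN by (simp add: matrix_vector_mul_assoc)
  qed
  moreover have "invertible (matrix_inv N)" "invertible \<nu>"
    using NN inv unfolding invertible_def by blast+
  ultimately show ?thesis unfolding admissible_def by blast
qed

section \<open>The generators of \<open>M_K\<close>\<close>

definition S_conj :: "(7 \<Rightarrow> 7) \<Rightarrow> real^7^7" where
  "S_conj \<sigma> = S ** perm_matrix \<sigma> ** matrix_inv S"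

lemma S_conj_comp: "S_conj (\<sigma> \<circ> \<tau>) = S_conj \<tau> ** S_conj \<sigma>"
proof -
  have "S_conj \<tau> ** S_conj \<sigma> = S ** perm_matrix \<tau> ** (matrix_inv S ** S) ** perm_matrix \<sigma> ** matrix_inv S"
    by (simp only: S_conj_def matrix_mul_assoc)
  then show ?thesis
    by (simp add: matrix_inv_mult[OF invertible_S] S_conj_def perm_matrix_comp matrix_mul_assoc)
qed

lemma S_conj_id: "S_conj id = mat 1"
  by (simp add: S_conj_def perm_matrix_id matrix_inv_mult[OF invertible_S])

lemma S_inverse_vector: obtains y where "x = S *v y" "S_conj \<sigma> *v x = S *v (\<chi> i. y $ \<sigma> i)"
proof (rule that[of "matrix_inv S *v x"])
  show "x = S *v (matrix_inv S *v x)"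
    by (simp add: matrix_vector_mul_assoc matrix_inv_mult[OF invertible_S])
  show "S_conj \<sigma> *v x = S *v (\<chi> i. (matrix_inv S *v x) $ \<sigma> i)"
    by (simp add: S_conj_def matrix_vector_mul_assoc [symmetric] perm_matrix_vector)
qed

text \<open>In the coordinates \<open>x = S *v y\<close> the matrix permutes the entries of
  \<open>y\<close> and fixes \<open>y$1\<close>, hence it permutes the six differences with
  \<open>y$1 / 2\<close>.\<close>

lemma intertwines_S_conj:
  assumes "\<sigma> 1 = 1" "\<And>i. idx_shift (\<tau> i) = \<sigma> (idx_shift i)"
  shows "intertwines (S_conj \<sigma>) (perm_matrix \<tau>)"
  unfolding intertwines_def
proof
  fix x
  obtain y where y: "x = S *v y" "S_conj \<sigma> *v x = S *v (\<chi> i. y $ \<sigma> i)" by (rule S_inverse_vector)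
  show "intertwiner (S_conj \<sigma> *v x) = perm_matrix \<tau> *v intertwiner x"
    unfolding y(2) unfolding y(1) intertwiner_S perm_matrix_vector using assms by simp
qed

text \<open>In the coordinates \<open>x = S *v y\<close> the form is the sum of all entries of
  \<open>y\<close> minus \<open>2 * y$1\<close>, which is visibly invariant.\<close>

lemma saal_form_S_conj:
  assumes "\<sigma> permutes UNIV" "\<sigma> 1 = 1"
  shows "saal_form (S_conj \<sigma> *v x) = saal_form x"
proof -
  obtain y where y: "x = S *v y" "S_conj \<sigma> *v x = S *v (\<chi> i. y $ \<sigma> i)" by (rule S_inverse_vector)
  have "saal_form (S *v z) = (\<Sum>i\<in>UNIV. z $ i) - 2 * z $ 1" for z
    by (simp add: saal_form_S sum_7)
  moreover have "(\<Sum>i\<in>UNIV. y $ \<sigma> i) = (\<Sum>i\<in>UNIV. y $ i)"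
    using sum.permute[OF assms(1), of "\<lambda>i. y $ i"] by (simp add: o_def)
  ultimately show ?thesis unfolding y(2) unfolding y(1) by (simp add: assms(2))
qed

lemma admissible_S_conj:
  assumes "\<sigma> permutes UNIV" "\<sigma> 1 = 1"
  shows "admissible (S_conj \<sigma>)"
proof -
  have bij: "bij \<sigma>" using assms(1) by (rule permutes_bij)
  \<comment> \<open>The restriction of \<open>\<sigma>\<close> to the six indices other than 1,
    renumbered from 1 to 6.\<close>
  define \<tau> where "\<tau> = inv_into UNIV idx_shift \<circ> \<sigma> \<circ> idx_shift"
  have range: "range idx_shift = UNIV - {1}" and inj: "inj idx_shift"
    using bij_idx_shift by (auto simp: bij_betw_def)
  have ne: "\<sigma> j \<noteq> 1" if "j \<noteq> 1" for j
    using that assms(2) bij by (metis bij_pointE)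
  have \<tau>: "idx_shift (\<tau> i) = \<sigma> (idx_shift i)" for i
    unfolding \<tau>_def o_def by (rule f_inv_into_f) (use range ne in auto)
  have "bij_betw \<sigma> (UNIV - {1}) (UNIV - {1})"
    using bij assms(2) by (metis bij_betw_DiffI bij_betw_singletonI subset_UNIV)
  then have "bij \<tau>"
    unfolding \<tau>_def using bij_betw_inv_into[OF bij_idx_shift] bij_idx_shift
    by (intro bij_betw_trans[of _ _ "UNIV - {1}"])
  moreover have "invertible (S_conj \<sigma>)"
  proof -
    have "invertible (matrix_inv S)" using matrix_inv_mult[OF invertible_S] unfolding invertible_def by blast
    then show ?thesis unfolding S_conj_def
      by (intro invertible_mult invertible_S invertible_perm_matrix bij)
  qed
  ultimately show ?thesis
    unfolding admissible_def using intertwines_S_conj[of \<sigma> \<tau>, OF assms(2) \<tau>] saal_form_S_conj[OF assms] invertible_perm_matrix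
    by blast
qed

definition tr12 :: "real^7^7" where "tr12 = perm_matrix (Transposition.transpose 1 2)"

text \<open>Exchanging \<open>x$1\<close> and \<open>x$2\<close> sends
  \<open>x$2 + x$4 - x$1 - x$3\<close> to the negative of \<open>x$2 + x$3 - x$1 - x$4\<close> and
  vice versa, while the other four coordinates involve only \<open>x$1 + x$2\<close>.\<close>

lemma intertwines_tr12: "intertwines tr12 (M6 (-1) 2 3)"
proof -
  have "M6 (-1) 2 3 *v v = vector [v $ 1, - v $ 3, - v $ 2, v $ 4, v $ 5, v $ 6]" for v
    unfolding vec_eq_iff forall_6 matrix_vector_mult_def vec_lambda_beta sum_6 M6_def perm_matrix_def vector_6
    by (simp add: Transposition.transpose_def)
  then show ?thesis
    by (simp add: intertwines_def tr12_def perm_matrix_vector intertwiner_def vec_eq_iff forall_6 Transposition.transpose_def)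
      (simp add: field_simps)
qed

lemma M6_minus_square: "M6 (-1) 2 3 ** M6 (-1) 2 3 = mat 1"
proof -
  have "M6 (-1) 2 3 *v v = vector [v $ 1, - v $ 3, - v $ 2, v $ 4, v $ 5, v $ 6]" for v
    unfolding vec_eq_iff forall_6 matrix_vector_mult_def vec_lambda_beta sum_6 M6_def perm_matrix_def vector_6
    by (simp add: Transposition.transpose_def)
  then show ?thesis
    by (simp add: matrix_eq matrix_vector_mul_assoc [symmetric] vec_eq_iff forall_6)
qed

lemma admissible_tr12: "admissible tr12"
proof -
  have "bij (Transposition.transpose 1 (2 :: 7))" by simp
  then have "invertible tr12" unfolding tr12_def by (rule invertible_perm_matrix)
  moreover have "saal_form (tr12 *v x) = saal_form x" for x
    by (simp add: tr12_def perm_matrix_vector saal_form_def Transposition.transpose_def)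
  moreover have "invertible (M6 (-1) 2 3)" using M6_minus_square unfolding invertible_def by blast
  ultimately show ?thesis unfolding admissible_def using intertwines_tr12 by blast
qed

lemma M6_one: "M6 1 i j = perm_matrix (Transposition.transpose i j)"
  by (auto simp: M6_def perm_matrix_def vec_eq_iff Transposition.transpose_def)

lemma G_K_eq: "G_K = {S_conj \<sigma> |\<sigma>. \<sigma> permutes UNIV \<and> \<sigma> 1 = 1}"
  by (auto simp: G_K_def P16_def S_conj_def)

lemma GL_inv:
  assumes "invertible A"
  shows "inv\<^bsub>GL\<^esub> A = matrix_inv A"
proof -
  interpret group "GL :: (real^'n^'n) monoid" by (rule group_GL)
  have "invertible (matrix_inv A)" using matrix_inv_mult[OF assms] unfolding invertible_def by blast
  then show ?thesis using matrix_inv_mult[OF assms] assms by (intro inv_equality) simp_all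
qed

lemma generators_admissible: "h \<in> G_K \<union> {tr12} \<Longrightarrow> admissible h"
  using admissible_S_conj admissible_tr12 by (auto simp: G_K_eq)

lemma M_K_eq: "M_K = generate GL (G_K \<union> {tr12})"
  by (simp add: M_K_def tr12_def)

lemma admissible_M_K: "\<mu> \<in> M_K \<Longrightarrow> admissible \<mu>"
  unfolding M_K_eq
proof (induction rule: generate.induct)
  case (inv h)
  then have h: "admissible h" by (rule generators_admissible)
  then have "invertible h" by (simp add: admissible_def)
  then show ?case using admissible_inverse[OF h] matrix_inv_mult[of h] by (simp add: GL_inv)
qed (auto simp: admissible_one admissible_mult generators_admissible)

lemma M_K_invertible: "\<mu> \<in> M_K \<Longrightarrow> invertible \<mu>"
  using admissible_M_K by (simp add: admissible_def)

lemma M_K_mult: "\<mu> \<in> M_K \<Longrightarrow> \<nu> \<in> M_K \<Longrightarrow> \<mu> ** \<nu> \<in> M_K"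
  unfolding M_K_eq using generate.eng[of \<mu> GL _ \<nu>] by simp

lemma S_conj_M_K: "\<sigma> permutes UNIV \<Longrightarrow> \<sigma> 1 = 1 \<Longrightarrow> S_conj \<sigma> \<in> M_K"
  unfolding M_K_eq by (rule generate.incl) (auto simp: G_K_eq)

lemma tr12_M_K: "tr12 \<in> M_K"
  unfolding M_K_eq by (rule generate.incl) simp

section \<open>Existence and uniqueness of \<theta>\<close>

definition signed_perm :: "real^7^7 \<Rightarrow> real^6^6" where
  "signed_perm = restrict (\<lambda>\<mu>. THE N. intertwines \<mu> N) M_K"

lemma signed_perm_eqI:
  assumes "\<mu> \<in> M_K" "intertwines \<mu> N"
  shows "signed_perm \<mu> = N"
  using assms intertwines_unique by (auto simp: signed_perm_def)

lemma signed_perm: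
  assumes "\<mu> \<in> M_K"
  shows "intertwines \<mu> (signed_perm \<mu>)" "invertible (signed_perm \<mu>)"
proof -
  obtain N where "invertible N" "intertwines \<mu> N"
    using admissible_M_K[OF assms] by (auto simp: admissible_def)
  then show "intertwines \<mu> (signed_perm \<mu>)" "invertible (signed_perm \<mu>)"
    using signed_perm_eqI[OF assms] by auto
qed

lemma transpose_permutes_UNIV: "Transposition.transpose i j permutes UNIV"
  by (rule permutes_swap_id) simp_all

definition theta_spec :: "(real^7^7 \<Rightarrow> real^6^6) \<Rightarrow> bool" where
  "theta_spec h \<longleftrightarrow> h \<in> extensional M_K
     \<and> h \<in> hom (GL\<lparr>carrier := M_K\<rparr>) GL
     \<and> inj_on h M_K
     \<and> (\<forall>i::nat\<in>{2..6}.
          h (S ** perm_matrix (Transposition.transpose (of_nat i) (of_nat (i + 1))) ** matrix_inv S)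
            = M6 1 (of_nat (i - 1)) (of_nat i))
     \<and> h (perm_matrix (Transposition.transpose 1 2)) = M6 (-1) 2 3"

lemma signed_perm_adjacent:
  assumes "i \<in> {2..6::nat}"
  shows "signed_perm (S_conj (Transposition.transpose (of_nat i) (of_nat (i + 1)))) = M6 1 (of_nat (i - 1)) (of_nat i)"
proof (rule signed_perm_eqI)
  have i: "i = 2 \<or> i = 3 \<or> i = 4 \<or> i = 5 \<or> i = 6" using assms by auto
  have fix1: "Transposition.transpose (of_nat i) (of_nat (i + 1)) (1 :: 7) = 1"
    using i by (auto simp: Transposition.transpose_def)
  show "S_conj (Transposition.transpose (of_nat i) (of_nat (i + 1))) \<in> M_K"
    by (rule S_conj_M_K[OF transpose_permutes_UNIV fix1])
  have "\<forall>j. idx_shift (Transposition.transpose (of_nat (i - 1)) (of_nat i) j)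
      = Transposition.transpose (of_nat i) (of_nat (i + 1)) (idx_shift j)"
    using i unfolding forall_6 by (elim disjE) (simp_all add: Transposition.transpose_def)
  then show "intertwines (S_conj (Transposition.transpose (of_nat i) (of_nat (i + 1)))) (M6 1 (of_nat (i - 1)) (of_nat i))"
    unfolding M6_one by (intro intertwines_S_conj fix1) blast
qed

text \<open>Each element of \<open>M_K\<close> intertwines with exactly one matrix because
  \<open>intertwiner\<close> is onto; this makes the assignment multiplicative. Equal images force
  equal \<open>intertwiner\<close> values, and invariance of \<open>saal_form\<close> then gives
  equality of the matrices.\<close>

lemma theta_spec_signed_perm: "theta_spec signed_perm"
  unfolding theta_spec_def
proof (intro conjI ballI)
  show "signed_perm \<in> extensional M_K" by (simp add: signed_perm_def)
  show "signed_perm \<in> hom (GL\<lparr>carrier := M_K\<rparr>) GL"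
    by (auto simp: hom_def signed_perm intro!: signed_perm_eqI intertwines_mult M_K_mult)
  show "inj_on signed_perm M_K"
  proof (rule inj_onI)
    fix \<mu> \<nu> assume *: "\<mu> \<in> M_K" "\<nu> \<in> M_K" "signed_perm \<mu> = signed_perm \<nu>"
    have "\<mu> *v x = \<nu> *v x" for x
    proof (rule intertwiner_inj)
      show "intertwiner (\<mu> *v x) = intertwiner (\<nu> *v x)"
        using signed_perm(1)[OF *(1)] signed_perm(1)[OF *(2)] *(3) by (simp add: intertwines_def)
      show "saal_form (\<mu> *v x) = saal_form (\<nu> *v x)"
        using admissible_M_K *(1,2) by (simp add: admissible_def)
    qed
    then show "\<mu> = \<nu>" by (simp add: matrix_eq)
  qed
  show "signed_perm (S ** perm_matrix (Transposition.transpose (of_nat i) (of_nat (i + 1))) ** matrix_inv S)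
      = M6 1 (of_nat (i - 1)) (of_nat i)" if "i \<in> {2..6}" for i
    using signed_perm_adjacent[OF that] by (simp add: S_conj_def)
  show "signed_perm (perm_matrix (Transposition.transpose 1 2)) = M6 (-1) 2 3"
    unfolding tr12_def [symmetric] by (rule signed_perm_eqI[OF tr12_M_K intertwines_tr12])
qed

lemma subgroup_M_K: "subgroup M_K GL"
proof -
  interpret group "GL :: (real^7^7) monoid" by (rule group_GL)
  have "invertible h" if "h \<in> G_K \<union> {tr12}" for h
    using generators_admissible[OF that] by (simp add: admissible_def)
  then show ?thesis unfolding M_K_eq by (intro generate_is_subgroup) auto
qed

text \<open>The conjugation \<open>(x z) = (x y)(y z)(x y)\<close> chains the adjacent
  transpositions to every \<open>(2 x)\<close>, and then links any \<open>a\<close> and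
  \<open>b\<close> through 2.\<close>

lemma transposition_in_closure:
  fixes B :: "(7 \<Rightarrow> 7) set"
  assumes comp: "\<And>\<sigma> \<tau>. \<sigma> \<in> B \<Longrightarrow> \<tau> \<in> B \<Longrightarrow> \<sigma> \<circ> \<tau> \<in> B" and id: "id \<in> B"
    and adj: "Transposition.transpose 2 3 \<in> B" "Transposition.transpose 3 4 \<in> B" "Transposition.transpose 4 5 \<in> B"
      "Transposition.transpose 5 6 \<in> B" "Transposition.transpose 6 7 \<in> B"
    and "a \<noteq> 1" "b \<noteq> 1"
  shows "Transposition.transpose a b \<in> B"
proof -
  have trans: "Transposition.transpose x z \<in> B"
    if "Transposition.transpose x y \<in> B" "Transposition.transpose y z \<in> B" for x y z :: 7
  proof (cases "x = z \<or> y = z")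
    case True
    then show ?thesis using id that by auto
  next
    case False
    then have "Transposition.transpose x z = Transposition.transpose x y \<circ> Transposition.transpose y z \<circ> Transposition.transpose x y"
      by (auto simp: fun_eq_iff transpose_triple)
    then show ?thesis using comp that by metis
  qed
  note t4 = trans[OF adj(1,2)]
  note t5 = trans[OF t4 adj(3)]
  note t6 = trans[OF t5 adj(4)]
  note t7 = trans[OF t6 adj(5)]
  have 2: "Transposition.transpose 2 x \<in> B" if "x \<noteq> 1" for x
  proof -
    have "x = 2 \<or> x = 3 \<or> x = 4 \<or> x = 5 \<or> x = 6 \<or> x = 7"
      using that UNIV_7 by auto
    moreover have "Transposition.transpose 2 2 \<in> B" using id by (simp only: transpose_same)
    ultimately show ?thesis using adj(1) t4 t5 t6 t7 by metis
  qed
  have "Transposition.transpose a 2 \<in> B" using 2[OF assms(8)] by (simp only: transpose_commute)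
  then show ?thesis using 2[OF assms(9)] by (rule trans)
qed

text \<open>The set where two candidates agree is a subgroup. Their values are prescribed only on
  adjacent transpositions and on \<open>(12)\<close>, so the work lies in reaching every permutation
  that fixes 1; \<open>M_K\<close> is then contained in the subgroup.\<close>

lemma theta_spec_unique:
  assumes "theta_spec h1" "theta_spec h2"
  shows "h1 = h2"
proof -
  interpret GL7: group "GL :: (real^7^7) monoid" by (rule group_GL)
  have mult: "h (\<mu> ** \<nu>) = h \<mu> ** h \<nu>" if "theta_spec h" "\<mu> \<in> M_K" "\<nu> \<in> M_K" for h \<mu> \<nu>
    using that by (auto simp: theta_spec_def hom_def)
  have hinv: "invertible (h \<mu>)" if "theta_spec h" "\<mu> \<in> M_K" for h \<mu>
    using that by (auto simp: theta_spec_def hom_def)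
  have one_M_K: "mat 1 \<in> M_K" using subgroup.one_closed[OF subgroup_M_K] by simp
  have one: "h (mat 1) = mat 1" if "theta_spec h" for h
  proof -
    have "h (mat 1) ** h (mat 1) = h (mat 1)" using mult[OF that one_M_K one_M_K] by simp
    then show ?thesis using hinv[OF that one_M_K] matrix_inv_mult[of "h (mat 1)"] by (metis matrix_mul_assoc matrix_mul_lid)
  qed
  define A where "A = {\<mu> \<in> M_K. h1 \<mu> = h2 \<mu>}"
  have "subgroup A GL"
  proof (rule GL7.subgroupI)
    show "A \<subseteq> carrier GL" using M_K_invertible by (auto simp: A_def)
    show "A \<noteq> {}" using one_M_K one[OF assms(1)] one[OF assms(2)] by (auto simp: A_def)
    show "\<mu> \<otimes>\<^bsub>GL\<^esub> \<nu> \<in> A" if "\<mu> \<in> A" "\<nu> \<in> A" for \<mu> \<nu>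
      using that mult[OF assms(1)] mult[OF assms(2)] M_K_mult by (auto simp: A_def)
    show "inv\<^bsub>GL\<^esub> \<mu> \<in> A" if "\<mu> \<in> A" for \<mu>
    proof -
      have \<mu>: "\<mu> \<in> M_K" "h1 \<mu> = h2 \<mu>" using that by (auto simp: A_def)
      note inv = M_K_invertible[OF \<mu>(1)]
      have m: "matrix_inv \<mu> \<in> M_K" using subgroup.m_inv_closed[OF subgroup_M_K \<mu>(1)] by (simp add: GL_inv[OF inv])
      have "h \<mu> ** h (matrix_inv \<mu>) = mat 1" "h (matrix_inv \<mu>) ** h \<mu> = mat 1" if "theta_spec h" for h
        using mult[OF that \<mu>(1) m] mult[OF that m \<mu>(1)] one[OF that] matrix_inv_mult[OF inv] by simp_all
      then have "h1 (matrix_inv \<mu>) = h2 (matrix_inv \<mu>)"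
        using assms \<mu>(2) matrix_inv_unique' by metis
      then show ?thesis using m by (simp add: A_def GL_inv[OF inv])
    qed
  qed
  then interpret A: subgroup A GL .
  have comp: "\<sigma> \<circ> \<tau> \<in> {\<sigma>. S_conj \<sigma> \<in> A}" if "\<sigma> \<in> {\<sigma>. S_conj \<sigma> \<in> A}" "\<tau> \<in> {\<sigma>. S_conj \<sigma> \<in> A}" for \<sigma> \<tau>
    using that A.m_closed by (simp add: S_conj_comp)
  have id_mem: "id \<in> {\<sigma>. S_conj \<sigma> \<in> A}" using A.one_closed by (simp add: S_conj_id)
  have adj: "Transposition.transpose (of_nat i) (of_nat (i + 1)) \<in> {\<sigma>. S_conj \<sigma> \<in> A}" if i: "i \<in> {2..6::nat}" for i
  proof -
    have "i = 2 \<or> i = 3 \<or> i = 4 \<or> i = 5 \<or> i = 6" using i by auto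
    then have "Transposition.transpose (of_nat i) (of_nat (i + 1)) (1 :: 7) = 1"
      by (auto simp: Transposition.transpose_def)
    then have mem: "S_conj (Transposition.transpose (of_nat i) (of_nat (i + 1))) \<in> M_K"
      by (rule S_conj_M_K[OF transpose_permutes_UNIV])
    have "h (S_conj (Transposition.transpose (of_nat i) (of_nat (i + 1)))) = M6 1 (of_nat (i - 1)) (of_nat i)"
      if "theta_spec h" for h
      using that i unfolding theta_spec_def S_conj_def by blast
    from this[OF assms(1)] this[OF assms(2)] and mem show ?thesis by (simp only: A_def mem_Collect_eq)
  qed
  have adj': "Transposition.transpose 2 3 \<in> {\<sigma>. S_conj \<sigma> \<in> A}" "Transposition.transpose 3 4 \<in> {\<sigma>. S_conj \<sigma> \<in> A}"
    "Transposition.transpose 4 5 \<in> {\<sigma>. S_conj \<sigma> \<in> A}" "Transposition.transpose 5 6 \<in> {\<sigma>. S_conj \<sigma> \<in> A}"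
    "Transposition.transpose 6 7 \<in> {\<sigma>. S_conj \<sigma> \<in> A}"
    using adj[of 2] adj[of 3] adj[of 4] adj[of 5] adj[of 6] by simp_all
  have tr: "Transposition.transpose a b \<in> {\<sigma>. S_conj \<sigma> \<in> A}" if "a \<noteq> 1" "b \<noteq> 1" for a b
    by (rule transposition_in_closure[OF comp id_mem adj' that])
  have "S_conj \<sigma> \<in> A" if "\<sigma> permutes UNIV" "\<sigma> 1 = 1" for \<sigma>
  proof -
    have "\<sigma> permutes (UNIV - {1})"
      using that by (auto simp: permutes_def)
    moreover have "finite (UNIV - {1 :: 7})" by simp
    ultimately show ?thesis
    proof (induction \<sigma> rule: permutes_induct)
      case id
      show ?case using id_mem by blast
    next
      case (swap a b p)
      then have "Transposition.transpose a b \<in> {\<sigma>. S_conj \<sigma> \<in> A}" "p \<in> {\<sigma>. S_conj \<sigma> \<in> A}"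
        using tr by auto
      from comp[OF this] show ?case by blast
    qed
  qed
  moreover have "tr12 \<in> A"
    using assms tr12_M_K by (simp add: A_def theta_spec_def tr12_def)
  ultimately have "G_K \<union> {tr12} \<subseteq> A" by (auto simp: G_K_eq)
  then have "M_K \<subseteq> A"
    unfolding M_K_eq by (rule GL7.generate_subgroup_incl) (rule \<open>subgroup A GL\<close>)
  show ?thesis
  proof (rule extensionalityI[of _ M_K])
    show "h1 x = h2 x" if "x \<in> M_K" for x using that \<open>M_K \<subseteq> A\<close> by (auto simp: A_def)
  qed (use assms in \<open>simp_all add: theta_spec_def\<close>)
qed

lemma \<theta>_eq: "\<theta> = signed_perm"
  unfolding \<theta>_def theta_spec_def [symmetric]
  by (rule the_equality) (rule theta_spec_signed_perm, rule theta_spec_unique, assumption, rule theta_spec_signed_perm)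

text \<open>This reduces the action of an inverse under \<theta> to finding one preimage in seven
  dimensions, so the matrices of \<open>p1\<close> and \<open>p2\<close> under \<theta> never have
  to be computed.\<close>

lemma matrix_inv_\<theta>:
  assumes "\<mu> \<in> M_K" "intertwiner (\<mu> *v x) = v"
  shows "matrix_inv (\<theta> \<mu>) *v v = intertwiner x"
proof -
  have "v = \<theta> \<mu> *v intertwiner x"
    using assms signed_perm(1)[OF assms(1)] by (simp add: \<theta>_eq intertwines_def)
  then show ?thesis
    using matrix_inv_mult[OF signed_perm(2)[OF assms(1)]] by (simp add: \<theta>_eq matrix_vector_mul_assoc)
qed

text \<open>A permutation matrix that commutes with \<open>S\<close> is its own conjugate by
  \<open>S\<close>, hence lies in \<open>G_K\<close>. This covers \<open>(23)\<close> and
  \<open>(34)\<close>.\<close>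

lemma perm_matrix_M_K:
  assumes "perm_matrix \<sigma> ** S = S ** perm_matrix \<sigma>" "\<sigma> permutes UNIV" "\<sigma> 1 = 1"
  shows "perm_matrix \<sigma> \<in> M_K"
proof -
  have "S_conj \<sigma> = perm_matrix \<sigma> ** (S ** matrix_inv S)"
    by (simp add: S_conj_def assms(1) [symmetric] matrix_mul_assoc)
  then show ?thesis using S_conj_M_K[OF assms(2,3)] by (simp add: matrix_inv_mult[OF invertible_S])
qed

lemma transposition_M_K:
  "perm_matrix (Transposition.transpose 1 2) \<in> M_K"
  "perm_matrix (Transposition.transpose 2 3) \<in> M_K"
  "perm_matrix (Transposition.transpose 3 4) \<in> M_K"
proof -
  show "perm_matrix (Transposition.transpose 1 2) \<in> M_K"
    using tr12_M_K by (simp add: tr12_def)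
  show "perm_matrix (Transposition.transpose 2 3) \<in> M_K"
    by (rule perm_matrix_M_K[OF _ transpose_permutes_UNIV])
      (simp_all add: matrix_eq matrix_vector_mul_assoc [symmetric] S_vector perm_matrix_vector vec_eq_iff forall_7 Transposition.transpose_def add_ac)
  show "perm_matrix (Transposition.transpose 3 4) \<in> M_K"
    by (rule perm_matrix_M_K[OF _ transpose_permutes_UNIV])
      (simp_all add: matrix_eq matrix_vector_mul_assoc [symmetric] S_vector perm_matrix_vector vec_eq_iff forall_7 Transposition.transpose_def add_ac)
qed

section \<open>The elements \<open>p0\<close>, \<open>p1\<close>, \<open>p2\<close> and their
  Hamming distances\<close>

lemma p_in_M_K: "p0 \<in> M_K" "p1 \<in> M_K" "p2 \<in> M_K"
proof -
  show "p0 \<in> M_K" using subgroup.one_closed[OF subgroup_M_K] by (simp add: p0_def)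
  have comp: "perm_matrix (\<sigma> \<circ> \<tau>) \<in> M_K" if "perm_matrix \<sigma> \<in> M_K" "perm_matrix \<tau> \<in> M_K" for \<sigma> \<tau>
    using M_K_mult[OF that(2,1)] by (simp add: perm_matrix_comp)
  have "cycle_of_list [1, 2, 3, 4 :: 7] = Transposition.transpose 1 2 \<circ> Transposition.transpose 2 3 \<circ> Transposition.transpose 3 4"
    by (simp add: o_assoc)
  then show "p1 \<in> M_K" unfolding p1_def using comp transposition_M_K by simp
  have "cycle_of_list [1, 3 :: 7] \<circ> cycle_of_list [2, 4] =
      (Transposition.transpose 1 2 \<circ> Transposition.transpose 2 3 \<circ> Transposition.transpose 1 2) \<circ>
      (Transposition.transpose 2 3 \<circ> Transposition.transpose 3 4 \<circ> Transposition.transpose 2 3)"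
    unfolding fun_eq_iff forall_7 by (simp add: Transposition.transpose_def)
  then show "p2 \<in> M_K" unfolding p2_def using comp transposition_M_K by simp
qed

lemma hamming_type_p: "hamming_type p0 p1 p2 = [2, 2, 2]"
proof -
  have w: "\<omega>\<^sub>0 = vector [1, 1, 1, 1, 1, 1]"
    by (simp add: \<omega>\<^sub>0_def vec_eq_iff forall_6)
  \<comment> \<open>The vector is \<open>S\<close> applied to \<open>(0, 1, ..., 1)\<close>. Its
    preimages under \<open>p1\<close> and \<open>p2\<close> used below just move the entry 0 to
    position 2 and to position 3.\<close>
  have J: "intertwiner (vector [0, 2, 2, 2, 4, 4, 4]) = vector [1, 1, 1, 1, 1, 1]"
    unfolding intertwiner_def vector_7 by simp
  have v0: "matrix_inv (\<theta> p0) *v \<omega>\<^sub>0 = vector [1, 1, 1, 1, 1, 1]"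
    using matrix_inv_\<theta>[OF p_in_M_K(1), of "vector [0, 2, 2, 2, 4, 4, 4]" \<omega>\<^sub>0] J by (simp add: w p0_def)
  have "p1 *v vector [2, 0, 2, 2, 4, 4, 4] = vector [0, 2, 2, 2, 4, 4, 4]"
    by (simp add: p1_def perm_matrix_vector vec_eq_iff forall_7 Transposition.transpose_def)
  then have v1: "matrix_inv (\<theta> p1) *v \<omega>\<^sub>0 = vector [1, -1, -1, 1, 1, 1]"
    using matrix_inv_\<theta>[OF p_in_M_K(2), of "vector [2, 0, 2, 2, 4, 4, 4]" \<omega>\<^sub>0] J by (simp add: w intertwiner_def)
  have "p2 *v vector [2, 2, 0, 2, 4, 4, 4] = vector [0, 2, 2, 2, 4, 4, 4]"
    by (simp add: p2_def perm_matrix_vector vec_eq_iff forall_7 Transposition.transpose_def)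
  then have v2: "matrix_inv (\<theta> p2) *v \<omega>\<^sub>0 = vector [-1, 1, -1, 1, 1, 1]"
    using matrix_inv_\<theta>[OF p_in_M_K(3), of "vector [2, 2, 0, 2, 4, 4, 4]" \<omega>\<^sub>0] J by (simp add: w intertwiner_def)
  have "{i. (matrix_inv (\<theta> p0) *v \<omega>\<^sub>0) $ i \<noteq> (matrix_inv (\<theta> p1) *v \<omega>\<^sub>0) $ i} = {2, 3}"
    "{i. (matrix_inv (\<theta> p0) *v \<omega>\<^sub>0) $ i \<noteq> (matrix_inv (\<theta> p2) *v \<omega>\<^sub>0) $ i} = {1, 3}"
    "{i. (matrix_inv (\<theta> p1) *v \<omega>\<^sub>0) $ i \<noteq> (matrix_inv (\<theta> p2) *v \<omega>\<^sub>0) $ i} = {1, 2}"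
    unfolding v0 v1 v2 set_eq_iff forall_6 by simp_all
  then show ?thesis by (simp add: hamming_type_def hamming_dist_def)
qed

text \<open>The two forms of the relation evaluate \<open>K\<close> at points that differ only in
  the order of the second to fourth parameters; this lemma and the next one identify them.\<close>

lemma K_rotate_bcd: "K (vector [a, c, d, b, e, f, g]) = K (vector [a, b, c, d, e, f, g])"
proof -
  have "F43_reg a c d b e f g = F43_reg a b c d e f g"
    by (simp add: F43_reg_def mult_ac)
  moreover have "F43_reg A B C D F G E = F43_reg A B C D E F G" for A B C D E F G
    by (simp add: F43_reg_def mult_ac)
  ultimately show ?thesis unfolding K_vector by (simp add: mult_ac)
qed

lemma K_swap_cd: "K (vector [a, b, d, c, e, f, g]) = K (vector [a, b, c, d, e, f, g])"
proof -
  have "F43_reg a b d c e f g = F43_reg a b c d e f g"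
    by (simp add: F43_reg_def mult_ac)
  then show ?thesis unfolding K_vector by (simp add: F43_reg_swap_lower mult_ac)
qed

theorem proposition6p3:
  shows "(\<forall>x\<in>V. \<alpha> x * K_mu p0 x + \<alpha> (act c123 x) * K_mu p1 x + \<alpha> (act c132 x) * K_mu p2 x = 0)
       \<and> (\<forall>x\<in>V. (\<Sum>j=0..2. \<alpha> ((act c123 ^^ j) x) * K ((act c123 ^^ j) x)) = 0)
       \<and> {p0, p1, p2} \<subseteq> M_K \<and> hamming_type p0 p1 p2 = [2, 2, 2]"
proof -
  have vec: "\<exists>a b c d e f g. x = vector [a, b, c, d, e, f, g] \<and> e + f + g - a - b - c - d = 1" if "x \<in> V" for x
  proof (intro exI conjI)
    show "x = vector [x$1, x$2, x$3, x$4, x$5, x$6, x$7]" by (simp add: vec_eq_iff forall_7)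
    show "x$5 + x$6 + x$7 - x$1 - x$2 - x$3 - x$4 = 1" using that by (simp add: V_def)
  qed
  have 1: "\<alpha> x * K_mu p0 x + \<alpha> (act c123 x) * K_mu p1 x + \<alpha> (act c132 x) * K_mu p2 x = 0" if "x \<in> V" for x
  proof -
    obtain a b c d e f g where x: "x = vector [a, b, c, d, e, f, g]" "e + f + g - a - b - c - d = 1"
      using vec[OF \<open>x \<in> V\<close>] by blast
    show ?thesis
      using K_relation[OF x(2)] unfolding x(1) K_mu_def act_explicit K_relation_lhs_def .
  qed
  have 2: "(\<Sum>j=0..2. \<alpha> ((act c123 ^^ j) x) * K ((act c123 ^^ j) x)) = 0" if "x \<in> V" for x
  proof -
    obtain a b c d e f g where x: "x = vector [a, b, c, d, e, f, g]" "e + f + g - a - b - c - d = 1"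
      using vec[OF \<open>x \<in> V\<close>] by blast
    have "{0..2} = {0, 1, 2 :: nat}" by auto
    then have "(\<Sum>j=0..2. \<alpha> ((act c123 ^^ j) x) * K ((act c123 ^^ j) x)) =
        \<alpha> x * K x + \<alpha> (act c123 x) * K (act c123 x) + \<alpha> (act c123 (act c123 x)) * K (act c123 (act c123 x))"
      by (simp add: numeral_2_eq_2)
    also have "\<dots> = K_relation_lhs a b c d e f g"
      unfolding x(1) act_explicit K_relation_lhs_def
      using K_swap_cd[of b c d a e f g] K_rotate_bcd[of c a b d e f g] by simp
    finally show ?thesis using K_relation[OF x(2)] by simp
  qed
  show ?thesis using 1 2 p_in_M_K hamming_type_p by blast
qed

end
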